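(* Let $d\in\{5,6,10,13,15,22,35,37,51,58,91,115,123,187,235,267,403,427\}$ and let $K=\mathbb{Q}(\sqrt{-d})$ (an imaginary quadratic field of class number $2$). Let $L_{\mathfrak{o}}$ and $L_{\mathfrak{a}}$ be the lattices in $\mathbb{R}^2$ attached to the principal ideal class $\mathfrak{o}$ and the nonprincipal ideal class $\mathfrak{a}$ of $K$. Then for every $m>0$, each nonempty shell $(L_{\mathfrak{o}})_m=\{x\in L_{\mathfrak{o}}:(x,x)=m\}$ and each nonempty shell $(L_{\mathfrak{a}})_m=\{x\in L_{\mathfrak{a}}:(x,x)=m\}$ is not a spherical $2$-design.
   Context: $(\cdot,\cdot)$ is the standard Euclidean inner product on $\mathbb{R}^2$. For an ideal class $\mathfrak{c}$ of $K$, let $f_{\mathfrak{c}}(x,y)=ax^2+bxy+cy^2$ be the reduced positive definite binary quadratic form of discriminant $d_K$ corresponding to $\mathfrak{c}$ (for an ideal $A=\mathbb{Z}\alpha+\mathbb{Z}\beta\in\mathfrak{c}$, $a=\alpha\bar\alpha/N(A)$, $b=(\alpha\bar\beta+\bar\alpha\beta)/N(A)$, $c=\beta\bar\beta/N(A)$); $L_{\mathfrak{c}}$ is a lattice in $\mathbb{R}^2$ with basis $v_1,v_2$ such that $(xv_1+yv_2,xv_1+yv_2)=f_{\mathfrak{c}}(x,y)$ (equivalently, an ideal $A\in\mathfrak{c}$, viewed in $\mathbb{C}\cong\mathbb{R}^2$, scaled by $N(A)^{-1/2}$). In particular $L_{\mathfrak{o}}$ is $\mathcal{O}_K\subset\mathbb{C}\cong\mathbb{R}^2$.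 Here $d_K=-4d$ if $-d\equiv 2,3\pmod 4$ and $d_K=-d$ if $-d\equiv1\pmod4$. A finite nonempty subset $X$ of a sphere $S^{n-1}(r)$ centered at the origin is a spherical $t$-design if the average of every polynomial of degree at most $t$ over $X$ equals its average over $S^{n-1}(r)$ with respect to surface measure. *)

theory Defs
  imports
    "HOL-Analysis.Analysis"
    "HOL-Algebra.QuotRing"
    "HOL-Computational_Algebra.Polynomial"
begin

text \<open>The field \<open>K = \<rat>(\<surd>-d)\<close> is realised inside the complex numbers.\<close>

definition imag_quad_field :: "nat \<Rightarrow> complex set" where
  "imag_quad_field d = {of_rat p + of_rat q * (\<i> * of_real (sqrt (real d))) | p q. True}"

definition ring_of_integers :: "nat \<Rightarrow> complex ring" where
  "ring_of_integers d =
     \<lparr>carrier = {z \<in> imag_quad_field d. algebraic_int z},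
      mult = (*), one = 1, zero = 0, add = (+)\<rparr>"

definition field_disc :: "nat \<Rightarrow> int" where
  "field_disc d = (if (- int d) mod 4 = 1 then - int d else - 4 * int d)"

definition nonzero_ideals :: "nat \<Rightarrow> complex set set" where
  "nonzero_ideals d = {A. ideal A (ring_of_integers d) \<and> A \<noteq> {0}}"

definition ideal_norm :: "nat \<Rightarrow> complex set \<Rightarrow> nat" where
  "ideal_norm d A = card (carrier (ring_of_integers d Quot A))"

text \<open>Every class of fractional ideals contains integral ideals, so the ideal classes are taken
  here as classes of nonzero integral ideals.\<close>

definition ideal_equiv :: "nat \<Rightarrow> (complex set \<times> complex set) set" where
  "ideal_equiv d =
     {(A, B). A \<in> nonzero_ideals d \<and> B \<in> nonzero_ideals d \<and>
        (\<exists>\<alpha>\<in>carrier (ring_of_integers d) - {0}. \<exists>\<beta>\<in>carrier (ring_of_integers d) - {0}.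
           (*) \<alpha> ` A = (*) \<beta> ` B)}"

definition ideal_classes :: "nat \<Rightarrow> complex set set set" where
  "ideal_classes d = nonzero_ideals d // ideal_equiv d"

definition principal_class :: "nat \<Rightarrow> complex set set" where
  "principal_class d = ideal_equiv d `` {carrier (ring_of_integers d)}"

definition reduced_form :: "int \<Rightarrow> int \<Rightarrow> int \<Rightarrow> bool" where
  "reduced_form a b c \<longleftrightarrow>
     a > 0 \<and> b\<^sup>2 - 4 * a * c < 0 \<and>
     \<bar>b\<bar> \<le> a \<and> a \<le> c \<and> (\<bar>b\<bar> = a \<or> a = c \<longrightarrow> b \<ge> 0)"

text \<open>\<open>class_form d \<cc> a b c\<close>: the form \<open>a x\<^sup>2 + b x y + c y\<^sup>2\<close> is the reduced form of the ideal
  class \<open>\<cc>\<close>. The bases \<open>\<alpha>, \<beta>\<close> are not oriented, so for a class of order greater than 2 both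
  signs of \<open>b\<close> are admitted (the associated lattices are isometric); for classes of order at
  most 2 the reduced form is unique.\<close>

definition class_form :: "nat \<Rightarrow> complex set set \<Rightarrow> int \<Rightarrow> int \<Rightarrow> int \<Rightarrow> bool" where
  "class_form d \<cc> a b c \<longleftrightarrow>
     reduced_form a b c \<and> b\<^sup>2 - 4 * a * c = field_disc d \<and>
     (\<exists>A\<in>\<cc>. \<exists>\<alpha> \<beta>.
        A = {of_int x * \<alpha> + of_int y * \<beta> | x y. True} \<and>
        of_int a = \<alpha> * cnj \<alpha> / of_nat (ideal_norm d A) \<and>
        of_int b = (\<alpha> * cnj \<beta> + cnj \<alpha> * \<beta>) / of_nat (ideal_norm d A) \<and>
        of_int c = \<beta> * cnj \<beta> / of_nat (ideal_norm d A))"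

text \<open>The lattice of a class is determined only up to isometry, hence a predicate.\<close>

definition class_lattice :: "nat \<Rightarrow> complex set set \<Rightarrow> (real^2) set \<Rightarrow> bool" where
  "class_lattice d \<cc> L \<longleftrightarrow>
     (\<exists>a b c v1 v2.
        class_form d \<cc> a b c \<and>
        v1 \<noteq> v2 \<and> independent {v1, v2} \<and>
        L = {of_int x *\<^sub>R v1 + of_int y *\<^sub>R v2 | x y. True} \<and>
        (\<forall>x y. (of_int x *\<^sub>R v1 + of_int y *\<^sub>R v2) \<bullet> (of_int x *\<^sub>R v1 + of_int y *\<^sub>R v2)
                 = of_int (a * x\<^sup>2 + b * x * y + c * y\<^sup>2)))"

definition shell :: "(real^'n) set \<Rightarrow> real \<Rightarrow> (real^'n) set" where
  "shell L m = {x \<in> L. x \<bullet> x = m}"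

definition polynomial_of_degree_le :: "nat \<Rightarrow> (real^'n \<Rightarrow> real) \<Rightarrow> bool" where
  "polynomial_of_degree_le t p \<longleftrightarrow>
     (\<exists>coef :: ('n \<Rightarrow> nat) \<Rightarrow> real.
        p = (\<lambda>x. \<Sum>k | (\<Sum>i\<in>UNIV. k i) \<le> t. coef k * (\<Prod>i\<in>UNIV. (x $ i) ^ k i)))"

text \<open>Surface measure on the sphere of radius \<open>r\<close> about the origin of \<open>\<real>\<^sup>n\<close>, as in polar
  coordinates: the measure of a part \<open>B\<close> of the sphere is \<open>n / r\<close> times the Lebesgue measure of
  the cone \<open>{s x | x \<in> B, 0 < s \<le> 1}\<close>, the preimage of \<open>B\<close> under radial projection of the
  punctured ball. For \<open>n = 2\<close> this is arc length.\<close>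

definition surface_measure :: "real \<Rightarrow> (real^'n) measure" where
  "surface_measure r =
     scale_measure (ennreal (real CARD('n) / r))
       (distr (restrict_space lborel (cball 0 r - {0})) borel (\<lambda>x. (r / norm x) *\<^sub>R x))"

definition spherical_design :: "nat \<Rightarrow> (real^'n) set \<Rightarrow> bool" where
  "spherical_design t X \<longleftrightarrow>
     finite X \<and> X \<noteq> {} \<and>
     (\<exists>r>0. X \<subseteq> sphere 0 r \<and>
        (\<forall>p. polynomial_of_degree_le t p \<longrightarrow>
           (\<Sum>x\<in>X. p x) / real (card X) =
           (LINT x|surface_measure r. p x) / measure (surface_measure r :: (real^'n) measure) (sphere 0 r)))"

end

(* Adjoin to the ring of integers O the elements of the ideal R of norm r divided by sqrt r, where R is
   a nonprincipal ramified prime ideal (r = 2 or r an odd prime divisor of d). The homogeneous elements of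
   the resulting Z/2-graded ring form a multiplicative monoid, closed under conjugation, with units 1 and -1
   and with unique factorization up to units, because every prime that could split is a value of one of the
   two reduced forms. The two graded pieces are isometric to the two lattices, and all homogeneous elements
   of norm n lie in the same piece.

   A shell that is a 2-design would make the sum of z^2 over all homogeneous z of norm n vanish. This sum
   is multiplicative: an inert or ramified prime contributes one nonzero factor per power, and a split
   prime p = pi * cnj pi contributes an integer satisfying a(k+1) = t a(k) - p^2 a(k-1) with
   t = pi^2 + cnj pi^2, hence congruent to t^k modulo p. It is nonzero because p divides t only if pi / cnj pi
   is a root of unity, that is, if p is ramified. *)

theory Submission
  imports Defs "HOL-Number_Theory.Number_Theory"
begin

text \<open>The obstacle is that the shells of one lattice do not multiply: a product of two
  elements of the nonprincipal class is principal, and the sum of z^2 over a single class has in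
  general no Euler product. A ramified R repairs this because R^2 = (r) and R is stable under
  conjugation, so scaling by 1 / sqrt r turns O and R into two pieces of one ring. R must be
  nonprincipal: a generator would put an element of norm 1 into the second piece, and the norm would
  no longer determine the grade.

  The unit group matters as well. A unit i or a primitive cube root of unity would make the sum of
  z^2 vanish identically; the same angles between \<pi> and its conjugate have to be excluded for
  split primes.

  The nonprincipal reduced form need not have leading coefficient r. For d = 15 it is 2 x^2 + x y +
  2 y^2, which takes the value r = 3 only off the axes, at (1, -1) and (-1, 1). This is why the
  alternative a = c, 2 a - |b| = r accompanies a = r throughout.\<close>

section \<open>Second moments of spherical 2-designs in the plane\<close>

lemma distr_lborel_orthogonal:
  fixes f :: "real^'n::{finite,wellorder} \<Rightarrow> real^'n::{finite,wellorder}"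
  assumes f: "orthogonal_transformation f"
  shows "distr lborel borel f = lborel"
proof (rule lborel_eqI[symmetric])
  have lin: "linear f" using f by (rule orthogonal_transformation_linear)
  then have meas: "f \<in> borel_measurable borel"
    by (intro borel_measurable_continuous_onI linear_continuous_on linear_linear[THEN iffD2])
  fix l u :: "real^'n::{finite,wellorder}"
  assume lu: "\<And>b. b \<in> Basis \<Longrightarrow> l \<bullet> b \<le> u \<bullet> b"
  have bij: "bij f" using f by (rule orthogonal_transformation_bij)
  have inv_f: "orthogonal_transformation (inv_into UNIV f)" using f by (rule orthogonal_transformation_inv)
  have leb: "emeasure lborel A = ennreal (measure lebesgue A)" if "A \<in> lmeasurable" "A \<in> sets borel" for A
  proof -
    have "emeasure lborel A = emeasure lebesgue A" using that by simp
    then show ?thesis using emeasure_eq_measure2[OF that(1)] by simp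
  qed
  have box: "box l u \<in> lmeasurable" by simp
  have pre: "f -` box l u = inv_into UNIV f ` box l u" by (rule bij_vimage_eq_inv_image[OF bij])
  have "f -` box l u \<in> lmeasurable"
    unfolding pre by (rule measurable_orthogonal_image[OF inv_f box])
  moreover have sets: "f -` box l u \<in> sets borel" using measurable_sets[OF meas, of "box l u"] by simp
  ultimately have "emeasure lborel (f -` box l u) = measure lebesgue (f -` box l u)"
    using leb by blast
  also have "\<dots> = emeasure lborel (box l u)"
    unfolding pre measure_orthogonal_image[OF inv_f box] using box by (simp add: leb)
  finally show "emeasure (distr lborel borel f) (box l u) = (\<Prod>b\<in>Basis. (u - l) \<bullet> b)"
    using lu meas by (simp add: emeasure_distr)
qed simp

lemma distr_surface_measure_orthogonal:
  fixes f :: "real^'n::{finite,wellorder} \<Rightarrow> real^'n::{finite,wellorder}"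
  assumes f: "orthogonal_transformation f"
  shows "distr (surface_measure r) borel f = surface_measure r"
proof (rule measure_eqI)
  show "sets (distr (surface_measure r) borel f) = sets (surface_measure r)"
    by (simp add: surface_measure_def)
  have lin: "linear f" using f by (rule orthogonal_transformation_linear)
  then have meas: "f \<in> borel_measurable borel"
    by (intro borel_measurable_continuous_onI linear_continuous_on linear_linear[THEN iffD2])
  let ?B = "cball 0 r - {0} :: (real^'n::{finite,wellorder}) set"
  let ?g = "\<lambda>x::real^'n::{finite,wellorder}. (r / norm x) *\<^sub>R x"
  have g: "?g \<in> borel_measurable borel" by measurable
  then have g': "?g \<in> measurable (restrict_space lborel ?B) borel"
    by (intro measurable_restrict_space1) simp
  have B: "?B \<in> sets borel" by simp
  have key: "emeasure (surface_measure r :: (real^'n::{finite,wellorder}) measure) A =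
      ennreal (real CARD('n::{finite,wellorder}) / r) * emeasure lborel (?g -` A \<inter> ?B)" if "A \<in> sets borel" for A
    unfolding surface_measure_def using that g' B
    by (simp add: emeasure_distr emeasure_restrict_space space_restrict_space)
  fix A assume "A \<in> sets (distr (surface_measure r) borel f)"
  then have A: "A \<in> sets borel" by simp
  have fA: "f -` A \<in> sets borel" using measurable_sets[OF meas A] by simp
  have gA: "?g -` A \<inter> ?B \<in> sets borel" using measurable_sets[OF g A] B by auto
  have nf: "norm (f x) = norm x" for x by (rule orthogonal_transformation_norm[OF f])
  \<comment> \<open>Radial projection commutes with \<open>f\<close>, because \<open>f\<close> is
    linear and preserves the norm.\<close>
  have "?g -` (f -` A) \<inter> ?B = f -` (?g -` A \<inter> ?B)"
    using nf linear_scale[OF lin] by (auto simp: linear_0[OF lin]) (metis norm_eq_zero)+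
  then have "emeasure lborel (?g -` (f -` A) \<inter> ?B) = emeasure (distr lborel borel f) (?g -` A \<inter> ?B)"
    using meas gA by (simp add: emeasure_distr)
  also have "\<dots> = emeasure lborel (?g -` A \<inter> ?B)"
    by (simp add: distr_lborel_orthogonal[OF f])
  finally have "emeasure (surface_measure r) (f -` A) = emeasure (surface_measure r) A"
    using key[OF A] key[OF fA] by simp
  moreover have "f \<in> measurable (surface_measure r) borel"
    using meas by (simp add: surface_measure_def)
  moreover have "space (surface_measure r :: (real^'n::{finite,wellorder}) measure) = UNIV"
    by (simp add: surface_measure_def space_scale_measure)
  ultimately show "emeasure (distr (surface_measure r) borel f) A = emeasure (surface_measure r) A"
    using A by (simp add: emeasure_distr)
qed

text \<open>Symmetry replaces the evaluation of any integral over the sphere: the substitution x ->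
  f x shows the integral to be its own negative.\<close>

lemma integral_surface_measure_odd:
  fixes f :: "real^'n::{finite,wellorder} \<Rightarrow> real^'n::{finite,wellorder}" and p :: "real^'n::{finite,wellorder} \<Rightarrow> real"
  assumes f: "orthogonal_transformation f" and p: "p \<in> borel_measurable borel"
    and odd: "\<And>x. p (f x) = - p x"
  shows "(LINT x|surface_measure r. p x) = 0"
proof -
  have lin: "linear f" using f by (rule orthogonal_transformation_linear)
  then have "f \<in> borel_measurable borel"
    by (intro borel_measurable_continuous_onI linear_continuous_on linear_linear[THEN iffD2])
  then have "f \<in> measurable (surface_measure r) borel" by (simp add: surface_measure_def)
  then have "(LINT x|surface_measure r. p (f x)) = (LINT x|distr (surface_measure r) borel f. p x)"
    by (simp add: integral_distr[OF _ p])
  then have "- (LINT x|surface_measure r. p x) = (LINT x|surface_measure r. p x)"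
    by (simp add: odd distr_surface_measure_orthogonal[OF f])
  then show ?thesis by simp
qed

text \<open>Multiplication by i. Degree 2 harmonic polynomials in the plane change sign under
  it.\<close>

definition rot90 :: "real^2 \<Rightarrow> real^2" where
  "rot90 x = vector [- x $ 2, x $ 1]"

lemma rot90_nth [simp]: "rot90 x $ 1 = - x $ 2" "rot90 x $ 2 = x $ 1"
  by (simp_all add: rot90_def)

lemma inner_real2: "x \<bullet> y = x $ 1 * y $ 1 + x $ 2 * y $ 2" for x y :: "real^2"
  by (simp add: inner_vec_def sum_2)

lemma orthogonal_transformation_rot90: "orthogonal_transformation rot90"
  unfolding orthogonal_transformation_def
  by (auto intro!: linearI simp: vec_eq_iff forall_2 inner_real2)

lemma polynomial_of_degree_le_quadratic:
  "polynomial_of_degree_le 2 (\<lambda>x::real^2. A * (x $ 1)\<^sup>2 + B * (x $ 1 * x $ 2) + C * (x $ 2)\<^sup>2)"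
proof -
  \<comment> \<open>\<open>k i j\<close> is the exponent vector of the monomial x1^i x2^j; the sum
    over all exponents of degree at most 2 collapses to the three purely quadratic ones.\<close>
  define k where "k i j = (\<lambda>n::2. if n = 1 then i else j)" for i j :: nat
  have k_eq: "k i j = k i' j' \<longleftrightarrow> i = i' \<and> j = j'" for i j i' j'
    by (auto simp: k_def fun_eq_iff) (metis exhaust_2 one_neq_zero zero_neq_one)+
  define coef where "coef = (\<lambda>n. if n = k 2 0 then A else if n = k 1 1 then B else if n = k 0 2 then C else 0)"
  have "finite {n :: 2 \<Rightarrow> nat. sum n UNIV \<le> 2}"
  proof (rule finite_subset)
    show "{n :: 2 \<Rightarrow> nat. sum n UNIV \<le> 2} \<subseteq> PiE UNIV (\<lambda>_. {..2})"
      by (auto simp: sum_2 PiE_def) (metis (full_types) exhaust_2 add_leD1 add_leD2)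
  qed (simp add: finite_PiE)
  moreover have "{k 2 0, k 1 1, k 0 2} \<subseteq> {n. sum n UNIV \<le> 2}"
    by (auto simp: k_def sum_2)
  ultimately have "(\<Sum>n | sum n UNIV \<le> 2. coef n * (\<Prod>i\<in>UNIV. x $ i ^ n i)) =
      (\<Sum>n\<in>{k 2 0, k 1 1, k 0 2}. coef n * (\<Prod>i\<in>UNIV. x $ i ^ n i))" for x
    by (intro sum.mono_neutral_right) (auto simp: coef_def)
  also have "\<dots> x = A * (x $ 1)\<^sup>2 + B * (x $ 1 * x $ 2) + C * (x $ 2)\<^sup>2" for x :: "real^2"
    by (simp add: k_eq coef_def) (simp add: k_def UNIV_2)
  finally show ?thesis unfolding polynomial_of_degree_le_def by (intro exI[of _ coef]) auto
qed

text \<open>The second moment of a 2-design is isotropic. The vectors v and \<open>rot90 v\<close>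
  are orthogonal of equal length, so the squares of the two inner products add up to (v . v)(x . x),
  while their difference is harmonic and averages to 0.\<close>

lemma spherical_2_design_second_moment:
  fixes X :: "(real^2) set" and v :: "real^2"
  assumes X: "spherical_design 2 X" and m: "\<And>x. x \<in> X \<Longrightarrow> x \<bullet> x = m"
  shows "2 * (\<Sum>x\<in>X. (x \<bullet> v)\<^sup>2) = (v \<bullet> v) * m * real (card X)"
proof -
  define p where "p x = (x \<bullet> v)\<^sup>2 - (x \<bullet> rot90 v)\<^sup>2" for x :: "real^2"
  have p: "p = (\<lambda>x. ((v $ 1)\<^sup>2 - (v $ 2)\<^sup>2) * (x $ 1)\<^sup>2 + (4 * v $ 1 * v $ 2) * (x $ 1 * x $ 2)
      + ((v $ 2)\<^sup>2 - (v $ 1)\<^sup>2) * (x $ 2)\<^sup>2)"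
    by (auto simp: p_def inner_real2 power2_eq_square algebra_simps)
  have poly: "polynomial_of_degree_le 2 p"
    unfolding p by (rule polynomial_of_degree_le_quadratic)
  have "p \<in> borel_measurable borel" unfolding p_def by measurable
  moreover have "p (rot90 x) = - p x" for x
    by (simp add: p_def inner_real2 power2_eq_square algebra_simps)
  ultimately have "(LINT x|surface_measure r. p x) = 0" for r
    by (intro integral_surface_measure_odd[OF orthogonal_transformation_rot90])
  \<comment> \<open>The total mass of the sphere need not be known: 0 divided by it is 0 in any
    case.\<close>
  then have "(\<Sum>x\<in>X. p x) / real (card X) = 0"
    using X poly unfolding spherical_design_def by (metis (full_types) div_0)
  moreover have "card X \<noteq> 0" using X by (simp add: spherical_design_def)
  ultimately have 1: "(\<Sum>x\<in>X. p x) = 0" by simp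
  have "2 * (x \<bullet> v)\<^sup>2 = (v \<bullet> v) * m + p x" if "x \<in> X" for x
    unfolding m[OF that, symmetric] p_def
    by (simp add: inner_real2 power2_eq_square algebra_simps)
  then have "2 * (\<Sum>x\<in>X. (x \<bullet> v)\<^sup>2) = (\<Sum>x\<in>X. (v \<bullet> v) * m + p x)"
    by (simp add: sum_distrib_left)
  also have "\<dots> = (v \<bullet> v) * m * real (card X)"
    by (simp add: sum.distrib 1)
  finally show ?thesis .
qed

section \<open>The graded monoid of homogeneous elements\<close>

text \<open>\<open>quad_elt d g u y\<close> is \<open>(u + y \<surd>-d) / (2 \<surd>g)\<close>.\<close>

definition quad_elt :: "int \<Rightarrow> int \<Rightarrow> int \<Rightarrow> int \<Rightarrow> complex" where
  "quad_elt d g u y = Complex (of_int u / (2 * sqrt (of_int g))) (of_int y * sqrt (of_int d) / (2 * sqrt (of_int g)))"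

lemma cmod_quad_elt:
  assumes "g > 0" "d > 0"
  shows "(cmod (quad_elt d g u y))\<^sup>2 = of_int (u\<^sup>2 + d * y\<^sup>2) / (4 * of_int g)"
  using assms by (simp add: quad_elt_def cmod_power2 power_divide power_mult_distrib add_divide_distrib)

text \<open>The denominators multiply to 4 sqrt(g h) = 2 k sqrt G, so \<open>k\<close> is the factor
  that the raw coordinates of the product must shed to be written over 2 sqrt G.\<close>

lemma quad_elt_mult:
  assumes "g > 0" "h > 0" "d > 0" "G > 0" "k > 0" "k\<^sup>2 * G = 4 * g * h"
    and "k * U = u * s - d * y * w" "k * Y = u * w + y * s"
  shows "quad_elt d g u y * quad_elt d h s w = quad_elt d G U Y"
proof -
  have "sqrt (of_int (k\<^sup>2 * G)) = sqrt (of_int (4 * g * h))" by (simp only: assms(6))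
  then have k: "of_int k * sqrt (of_int G) = 2 * sqrt (of_int g) * sqrt (of_int h)"
    using assms(5) by (simp add: real_sqrt_mult)
  have d: "sqrt (of_int d) * sqrt (of_int d) = of_int d" using assms by simp
  have "of_int u * of_int s - of_int d * of_int y * of_int w = of_int k * (of_int U :: real)"
    using assms(7) by (metis of_int_diff of_int_mult)
  then have 1: "Re (quad_elt d g u y * quad_elt d h s w) = of_int k * of_int U / (2 * (2 * sqrt (of_int g) * sqrt (of_int h)))"
    using d assms by (simp add: quad_elt_def field_simps) 
  have "of_int u * of_int w + of_int y * of_int s = of_int k * (of_int Y :: real)"
    using assms(8) by (metis of_int_add of_int_mult)
  then have "(of_int u * of_int w + of_int y * of_int s) * sqrt (of_int d) = of_int k * of_int Y * sqrt (of_int d)"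
    by (simp only:)
  then have 2: "Im (quad_elt d g u y * quad_elt d h s w) = of_int k * of_int Y * sqrt (of_int d) / (2 * (2 * sqrt (of_int g) * sqrt (of_int h)))"
    using assms(1-5) by (simp add: quad_elt_def field_simps)
  show ?thesis
    using assms(1-5) 1 2 by (intro complex_eqI) (simp_all only: flip: k, simp_all add: quad_elt_def)
qed

lemma cnj_quad_elt: "cnj (quad_elt d g u y) = quad_elt d g u (- y)"
  by (simp add: quad_elt_def complex_eq_iff)

lemma uminus_quad_elt: "- quad_elt d g u y = quad_elt d g (- u) (- y)"
  by (simp add: quad_elt_def complex_eq_iff)

lemma quad_elt_divide: "k \<noteq> 0 \<Longrightarrow> quad_elt d g (k * u) (k * y) / of_int k = quad_elt d g u y"
  unfolding of_real_of_int_eq[symmetric, where 'a = complex]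
  by (simp add: quad_elt_def complex_eq_iff Re_divide_of_real Im_divide_of_real)

lemma quad_elt_eq_iff:
  assumes "g > 0" "d > 0"
  shows "quad_elt d g u y = quad_elt d g u' y' \<longleftrightarrow> u = u' \<and> y = y'"
  using assms by (simp add: quad_elt_def complex_eq_iff)

text \<open>Modulo 4 a square depends only on the parity of its root, so the bits \<open>i\<close>,
  \<open>j\<close> of u and y decide everything.\<close>

lemma even_square_sum_mod4:
  fixes d u y :: int
  assumes "4 dvd u\<^sup>2 + d * y\<^sup>2"
  shows "d mod 4 = 3 \<Longrightarrow> even (u + y)"
    and "d mod 4 \<in> {1, 2} \<Longrightarrow> even u" "d mod 4 \<in> {1, 2} \<Longrightarrow> even y"
proof -
  define q where "q = d mod 4"
  obtain a i b j e where u: "u = 2 * a + i" "i \<in> {0,1}" and y: "y = 2 * b + j" "j \<in> {0,1}"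
    and d: "d = 4 * e + q"
    unfolding q_def by (metis (no_types, lifting) insertCI mult_div_mod_eq mod2_eq_if)
  have "u\<^sup>2 + d * y\<^sup>2 = 4 * (a\<^sup>2 + a * i + d * (b\<^sup>2 + b * j) + e * j\<^sup>2) + (i\<^sup>2 + q * j\<^sup>2)"
    unfolding u y d by (simp add: power2_eq_square algebra_simps)
  then have "4 dvd i\<^sup>2 + q * j\<^sup>2"
    using assms by (metis dvd_add_right_iff dvd_triv_left)
  then have *: "4 dvd i\<^sup>2 + (d mod 4) * j\<^sup>2" by (simp add: q_def)
  show "d mod 4 = 3 \<Longrightarrow> even (u + y)" using * u y by auto
  show "d mod 4 \<in> {1, 2} \<Longrightarrow> even u" "d mod 4 \<in> {1, 2} \<Longrightarrow> even y" using * u y by auto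
qed

text \<open>\<open>hecke_coeff p t k\<close> is the coefficient at \<open>p\<^sup>k\<close> of the Euler factor \<open>1 / (1 - t X + p\<^sup>2 X\<^sup>2)\<close>.\<close>

fun hecke_coeff :: "int \<Rightarrow> int \<Rightarrow> nat \<Rightarrow> int" where
  "hecke_coeff p t 0 = 1"
| "hecke_coeff p t (Suc 0) = t"
| "hecke_coeff p t (Suc (Suc k)) = t * hecke_coeff p t (Suc k) - p\<^sup>2 * hecke_coeff p t k"

lemma hecke_coeff_nonzero:
  assumes "prime p" "\<not> p dvd t"
  shows "hecke_coeff p t k \<noteq> 0"
proof -
  have "[hecke_coeff p t k = t ^ k] (mod p)"
  proof (induction p t k rule: hecke_coeff.induct)
    case (3 p t k)
    have "[t * hecke_coeff p t (Suc k) - p\<^sup>2 * hecke_coeff p t k = t * t ^ Suc k - 0 * hecke_coeff p t k] (mod p)"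
      by (intro cong_diff cong_mult 3 cong_refl) (simp add: cong_0_iff power2_eq_square)
    then show ?case by simp
  qed simp_all
  moreover have "\<not> p dvd t ^ k" using assms prime_dvd_power by blast
  ultimately have "\<not> p dvd hecke_coeff p t k" using cong_dvd_iff by blast
  then show ?thesis by auto
qed

text \<open>The last assumption says that the class number is 2: the reduced forms are the principal form and
  forms representing \<open>r\<close>. The assumptions \<open>no_i\<close> and \<open>no_omega\<close> exclude units of order 4 and 6.\<close>

locale two_class =
  fixes d r :: int
  assumes prime_r: "prime r"
    and ram: "(r = 2 \<and> d mod 4 \<in> {1, 2}) \<or> (odd r \<and> r dvd d \<and> \<not> r\<^sup>2 dvd d \<and> d mod 4 = 3)"
    and d_gt_4: "d > 4"
    and no_norm_r: "u\<^sup>2 + d * y\<^sup>2 \<noteq> 4 * r"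
    and no_i: "d \<noteq> q\<^sup>2"
    and no_omega: "3 * d \<noteq> q\<^sup>2"
    and reduced: "\<lbrakk>\<bar>b\<bar> \<le> a; a \<le> c; b\<^sup>2 - 4 * a * c = (if d mod 4 = 3 then - d else - 4 * d)\<rbrakk>
      \<Longrightarrow> a = 1 \<or> a = r \<or> a = c \<and> 2 * a - \<bar>b\<bar> = r"
begin

section \<open>Congruences for the coordinates and multiplication of the grades\<close>

lemma r_gt_1: "r > 1" using prime_r by (rule prime_gt_1_int)

lemma r_dvd: 
  assumes "4 * r dvd u\<^sup>2 + d * y\<^sup>2" shows "r dvd u"
  using ram
proof
  assume *: "r = 2 \<and> d mod 4 \<in> {1, 2}"
  have "4 dvd u\<^sup>2 + d * y\<^sup>2" using assms by (rule dvd_mult_left)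
  then show ?thesis using * even_square_sum_mod4(2) by blast
next
  assume *: "odd r \<and> r dvd d \<and> \<not> r\<^sup>2 dvd d \<and> d mod 4 = 3"
  have "r dvd u\<^sup>2 + d * y\<^sup>2" using assms by (rule dvd_mult_right)
  then have "r dvd u\<^sup>2" using * by (simp add: dvd_add_left_iff)
  then show ?thesis using prime_r prime_dvd_power by blast
qed

lemma parity: 
  assumes "4 * g dvd u\<^sup>2 + d * y\<^sup>2"
  shows "(d mod 4 = 3 \<and> odd r \<and> even (u + y)) \<or> (d mod 4 \<in> {1, 2} \<and> r = 2 \<and> even u \<and> even y)"
proof -
  have "4 dvd u\<^sup>2 + d * y\<^sup>2" using assms by (rule dvd_mult_left)
  then show ?thesis using even_square_sum_mod4 ram by blast
qed

text \<open>\<open>grade 1\<close> is the ring of integers and \<open>grade r\<close> is the ramified prime ideal of norm \<open>r\<close>, scaled by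
  \<open>1 / \<surd>r\<close>; the integrality of the norm already forces the congruences between \<open>u\<close> and \<open>y\<close>.\<close>

definition grade :: "int \<Rightarrow> complex set" where
  "grade g = {quad_elt d g u y | u y. 4 * g dvd u\<^sup>2 + d * y\<^sup>2}"

definition homog :: "complex set" where "homog = grade 1 \<union> grade r"

lemma gradeI: "4 * g dvd u\<^sup>2 + d * y\<^sup>2 \<Longrightarrow> quad_elt d g u y \<in> grade g"
  by (auto simp: grade_def)

lemma homogI: "g \<in> {1, r} \<Longrightarrow> 4 * g dvd u\<^sup>2 + d * y\<^sup>2 \<Longrightarrow> quad_elt d g u y \<in> homog"
  by (auto simp: grade_def homog_def)

lemma homogE:
  assumes "z \<in> homog"
  obtains g u y where "g \<in> {1, r}" "g > 0" "4 * g dvd u\<^sup>2 + d * y\<^sup>2" "z = quad_elt d g u y"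
  using assms r_gt_1 by (fastforce simp: grade_def homog_def)

text \<open>\<open>k\<close> is the factor that cancels when a product is brought back to the form
  \<open>quad_elt\<close>: the grades multiply as in \<open>\<int>/2\<close>.\<close>

lemma mult_coords:
  assumes g: "g \<in> {1, r}" and h: "h \<in> {1, r}"
    and m: "u\<^sup>2 + d * y\<^sup>2 = 4 * g * m" and n: "s\<^sup>2 + d * w\<^sup>2 = 4 * h * n"
  defines "k \<equiv> if g = r \<and> h = r then 2 * r else 2"
    and "G \<equiv> if g = h then 1 else r"
  obtains U Y where "k * U = u * s - d * y * w" "k * Y = u * w + y * s"
    "quad_elt d g u y * quad_elt d h s w = quad_elt d G U Y" "U\<^sup>2 + d * Y\<^sup>2 = 4 * G * (m * n)"
proof -
  have u: "4 * g dvd u\<^sup>2 + d * y\<^sup>2" and s: "4 * h dvd s\<^sup>2 + d * w\<^sup>2" using m n by simp_all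
  have r1: "r > 1" "r \<noteq> 1" using r_gt_1 by auto
  have pos: "g > 0" "h > 0" "d > 0" "G > 0" "k > 0" using g h r1 d_gt_4 by (auto simp: G_def k_def)
  have kG: "k\<^sup>2 * G = 4 * g * h"
    using g h r1 by (auto simp: k_def G_def power2_eq_square)
  \<comment> \<open>Divisibility by 4 is needed for r = 2, where two factors of grade r give k =
    4.\<close>
  have "even (u * s - d * y * w) \<and> even (u * w + y * s) \<and>
     (r = 2 \<longrightarrow> 4 dvd u * s - d * y * w \<and> 4 dvd u * w + y * s)"
  proof (cases "d mod 4 = 3")
    case True
    then have "odd r" "even (u + y)" "even (s + w)" using parity[OF u] parity[OF s] by auto
    moreover have "odd d" using True by presburger
    ultimately show ?thesis by auto
  next
    case False
    then have "even u" "even y" "even s" "even w" using parity[OF u] parity[OF s] by auto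
    then obtain a b a' b' where "u = 2 * a" "y = 2 * b" "s = 2 * a'" "w = 2 * b'" by (auto elim!: evenE)
    then have "u * s - d * y * w = 4 * (a * a' - d * b * b')" "u * w + y * s = 4 * (a * b' + b * a')"
      by (simp_all add: algebra_simps)
    then show ?thesis by (metis dvd_triv_left dvd_mult_left numeral_Bit0_eq_double)
  qed
  note ev = this
  have "k dvd u * s - d * y * w \<and> k dvd u * w + y * s"
  proof (cases "g = r \<and> h = r")
    case True
    show ?thesis
    proof (cases "r = 2")
      case True then show ?thesis using ev by (simp add: k_def)
    next
      case False
      then have *: "odd r" "r dvd d" using ram by auto
      have "r dvd u" "r dvd s" using True u s r_dvd by auto
      then have "r dvd u * s - d * y * w" "r dvd u * w + y * s"
        using * by (simp_all add: mult.assoc)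
      moreover have "coprime 2 r" using * by simp
      ultimately show ?thesis using ev True by (simp add: k_def divides_mult)
    qed
  next
    case False then show ?thesis using ev by (auto simp: k_def)
  qed
  then obtain U Y where UY: "k * U = u * s - d * y * w" "k * Y = u * w + y * s"
    by (metis dvdE)
  have "k\<^sup>2 * (U\<^sup>2 + d * Y\<^sup>2) = (k * U)\<^sup>2 + d * (k * Y)\<^sup>2" by (simp add: power_mult_distrib algebra_simps)
  \<comment> \<open>Brahmagupta's identity.\<close>
  also have "\<dots> = (u\<^sup>2 + d * y\<^sup>2) * (s\<^sup>2 + d * w\<^sup>2)"
    unfolding UY by (simp add: power2_eq_square algebra_simps)
  finally have N: "k\<^sup>2 * (U\<^sup>2 + d * Y\<^sup>2) = (u\<^sup>2 + d * y\<^sup>2) * (s\<^sup>2 + d * w\<^sup>2)" .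
  have "k\<^sup>2 * (U\<^sup>2 + d * Y\<^sup>2) = (4 * g * m) * (4 * h * n)" using N m n by simp
  also have "\<dots> = 4 * (m * n) * (4 * g * h)" by (simp add: algebra_simps)
  also have "\<dots> = k\<^sup>2 * (4 * G * (m * n))" unfolding kG[symmetric] by (simp add: algebra_simps)
  finally have "k\<^sup>2 * (U\<^sup>2 + d * Y\<^sup>2) = k\<^sup>2 * (4 * G * (m * n))" .
  then have "U\<^sup>2 + d * Y\<^sup>2 = 4 * G * (m * n)" using pos by simp
  then show ?thesis
    using that UY N quad_elt_mult[OF pos(1-5) kG UY] by simp
qed

lemma grade_mult:
  assumes "g \<in> {1, r}" "h \<in> {1, r}" "a \<in> grade g" "b \<in> grade h"
  shows "a * b \<in> grade (if g = h then 1 else r)"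
proof -
  obtain u y m s w n where a: "u\<^sup>2 + d * y\<^sup>2 = 4 * g * m" "a = quad_elt d g u y"
    and b: "s\<^sup>2 + d * w\<^sup>2 = 4 * h * n" "b = quad_elt d h s w"
    using assms by (auto simp: grade_def elim!: dvdE)
  show ?thesis
    by (rule mult_coords[OF assms(1,2) a(1) b(1)]) (use a b in \<open>auto intro: gradeI\<close>)
qed

lemma mult_homog: "a \<in> homog \<Longrightarrow> b \<in> homog \<Longrightarrow> a * b \<in> homog"
  unfolding homog_def using grade_mult r_gt_1 by (smt (verit) UnE UnI1 UnI2 insertCI)

lemma cnj_grade: "a \<in> grade g \<Longrightarrow> cnj a \<in> grade g"
  by (auto simp: grade_def cnj_quad_elt) (metis power2_minus)

lemma uminus_grade: "a \<in> grade g \<Longrightarrow> - a \<in> grade g"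
  by (auto simp: grade_def uminus_quad_elt) (metis power2_minus)

lemma cnj_homog: "a \<in> homog \<Longrightarrow> cnj a \<in> homog"
  using cnj_grade by (auto simp: homog_def)

lemma uminus_homog: "a \<in> homog \<Longrightarrow> - a \<in> homog"
  using uminus_grade by (auto simp: homog_def)

lemma int_mult_grade: "a \<in> grade g \<Longrightarrow> of_int k * a \<in> grade g"
proof -
  assume "a \<in> grade g"
  then obtain u y where a: "4 * g dvd u\<^sup>2 + d * y\<^sup>2" "a = quad_elt d g u y" by (auto simp: grade_def)
  have "of_int k * a = quad_elt d g (k * u) (k * y)"
    by (simp add: a quad_elt_def complex_eq_iff)
  moreover have "(k * u)\<^sup>2 + d * (k * y)\<^sup>2 = (u\<^sup>2 + d * y\<^sup>2) * k\<^sup>2" by (simp add: power_mult_distrib algebra_simps)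
  ultimately show ?thesis using a gradeI by (metis dvd_mult2)
qed

lemma int_mult_homog: "a \<in> homog \<Longrightarrow> of_int k * a \<in> homog"
  using int_mult_grade by (auto simp: homog_def)

lemma cmod_grade:
  assumes "g \<in> {1, r}"
  shows "(cmod (quad_elt d g u y))\<^sup>2 = of_int n \<longleftrightarrow> u\<^sup>2 + d * y\<^sup>2 = 4 * g * n"
proof -
  have pos: "g > 0" "d > 0" using assms r_gt_1 d_gt_4 by auto
  have "(cmod (quad_elt d g u y))\<^sup>2 = of_int n \<longleftrightarrow> real_of_int (u\<^sup>2 + d * y\<^sup>2) = of_int (4 * g * n)"
    unfolding cmod_quad_elt[OF pos] using pos by (simp add: field_simps)
  then show ?thesis by (simp only: of_int_eq_iff)
qed

section \<open>Elements of given norm and their division by primes\<close>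

definition norm_set :: "int \<Rightarrow> complex set" where
  "norm_set n = {z \<in> homog. (cmod z)\<^sup>2 = of_int n}"

lemma norm_set_E:
  assumes "z \<in> norm_set n"
  obtains g u y where "g \<in> {1, r}" "u\<^sup>2 + d * y\<^sup>2 = 4 * g * n" "z = quad_elt d g u y"
proof -
  have z: "z \<in> homog" and n: "(cmod z)\<^sup>2 = of_int n" using assms by (simp_all add: norm_set_def)
  from z obtain g u y where g: "g \<in> {1, r}" and "g > 0" and "4 * g dvd u\<^sup>2 + d * y\<^sup>2" and z: "z = quad_elt d g u y"
    by (rule homogE)
  then show thesis using that[OF g _ z] n cmod_grade[OF g] by simp
qed

lemma norm_set_I:
  assumes "g \<in> {1, r}" "u\<^sup>2 + d * y\<^sup>2 = 4 * g * n"
  shows "quad_elt d g u y \<in> norm_set n"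
  using assms cmod_grade by (auto simp: norm_set_def intro!: homogI)

lemma homog_norm: 
  assumes "z \<in> homog" obtains n where "(cmod z)\<^sup>2 = of_int n" "z \<in> norm_set n"
proof -
  obtain g u y where g: "g \<in> {1, r}" and "4 * g dvd u\<^sup>2 + d * y\<^sup>2" and z: "z = quad_elt d g u y"
    using assms by (rule homogE)
  then obtain n where "u\<^sup>2 + d * y\<^sup>2 = 4 * g * n" by (elim dvdE)
  then have "z \<in> norm_set n" using g z norm_set_I by blast
  then show ?thesis using that by (simp add: norm_set_def)
qed

lemma mult_norm_set: "a \<in> norm_set m \<Longrightarrow> b \<in> norm_set n \<Longrightarrow> a * b \<in> norm_set (m * n)"
  by (simp add: norm_set_def mult_homog norm_mult power_mult_distrib)

lemma cnj_norm_set: "a \<in> norm_set m \<Longrightarrow> cnj a \<in> norm_set m"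
  by (simp add: norm_set_def cnj_homog)

lemma uminus_norm_set: "a \<in> norm_set m \<Longrightarrow> - a \<in> norm_set m"
  by (simp add: norm_set_def uminus_homog)

lemma norm_set_mult_cnj: "a \<in> norm_set m \<Longrightarrow> a * cnj a = of_int m"
  unfolding complex_norm_square[symmetric] by (simp add: norm_set_def flip: of_real_power)

lemma finite_norm_set: "finite (norm_set n)"
proof -
  let ?B = "{- \<bar>4 * r * n\<bar>..\<bar>4 * r * n\<bar>}"
  have "norm_set n \<subseteq> (\<lambda>(g, u, y). quad_elt d g u y) ` ({1, r} \<times> ?B \<times> ?B)"
  proof
    fix z assume "z \<in> norm_set n"
    then obtain g u y where z: "g \<in> {1, r}" "u\<^sup>2 + d * y\<^sup>2 = 4 * g * n" "z = quad_elt d g u y" by (rule norm_set_E)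
    have "4 * g * n \<ge> 0" using d_gt_4 unfolding z(2)[symmetric] by simp
    then have n: "n \<ge> 0" using z(1) r_gt_1 by (auto simp: zero_le_mult_iff)
    have abs_le: "\<bar>x\<bar> \<le> x\<^sup>2" for x :: int
      using self_le_power[of "\<bar>x\<bar>" 2] by (cases "x = 0") simp_all
    have "\<bar>y\<bar> \<le> y\<^sup>2" "\<bar>u\<bar> \<le> u\<^sup>2" by (rule abs_le)+
    moreover have "y\<^sup>2 \<le> d * y\<^sup>2" using d_gt_4 by (simp add: mult_le_cancel_right1)
    moreover have "g \<le> r" using z r_gt_1 by auto
    then have "4 * g * n \<le> 4 * r * n" using n by (simp add: mult_right_mono)
    ultimately have "\<bar>y\<bar> \<le> 4 * r * n" "\<bar>u\<bar> \<le> 4 * r * n" using z(2) by (smt (verit) zero_le_power2)+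
    then show "z \<in> (\<lambda>(g, u, y). quad_elt d g u y) ` ({1, r} \<times> ?B \<times> ?B)"
      using z by (intro image_eqI[of _ _ "(g, u, y)"]) auto
  qed
  then show ?thesis by (rule finite_subset) auto
qed

text \<open>Since p^2 divides the norm, divisibility of the second coordinate by p forces that of
  the first. Later arguments therefore only watch \<open>Y\<close>.\<close>

lemma exact_division:
  assumes G: "G \<in> {1, r}" and N: "U\<^sup>2 + d * Y\<^sup>2 = 4 * G * (p * (p * n))" and p: "prime p" and Y: "p dvd Y"
  shows "quad_elt d G U Y / of_int p \<in> homog"
proof -
  have p0: "p \<noteq> 0" using p by auto
  obtain Y' where Y': "Y = p * Y'" using Y by blast
  have "U\<^sup>2 = p\<^sup>2 * (4 * G * n - d * Y'\<^sup>2)" using N by (simp add: Y' power2_eq_square algebra_simps)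
  then have "p dvd U" using p prime_dvd_power by (metis dvd_triv_left dvd_mult_left power2_eq_square)
  then obtain U' where U': "U = p * U'" by blast
  have "p\<^sup>2 * (U'\<^sup>2 + d * Y'\<^sup>2) = p\<^sup>2 * (4 * G * n)" using N by (simp add: U' Y' power2_eq_square algebra_simps)
  then have "U'\<^sup>2 + d * Y'\<^sup>2 = 4 * G * n" using p0 by simp
  then have "quad_elt d G U' Y' \<in> homog" using G by (intro homogI) auto
  then show ?thesis using p0 by (simp add: U' Y' quad_elt_divide)
qed

text \<open>Euclid's lemma for the graded monoid, without ideals. The second coordinates of \<alpha>
  \<pi> and \<alpha> cnj \<pi> have, up to the factor k^2, the product y^2 N(s,w) - w^2 N(u,y) with
  N(u,y) = u^2 + d y^2. Both norms are multiples of p, so p divides one of the two coordinates;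
  dividing by p = \<pi> cnj \<pi> then leaves \<alpha> / cnj \<pi> or \<alpha> / \<pi>.\<close>

lemma divides_either:
  assumes p: "prime p" "p \<noteq> r" and \<alpha>: "\<alpha> \<in> norm_set (p * n)" and \<pi>: "\<pi> \<in> norm_set p"
  shows "\<alpha> / \<pi> \<in> homog \<or> \<alpha> / cnj \<pi> \<in> homog"
proof -
  obtain g u y where g: "g \<in> {1, r}" and u: "u\<^sup>2 + d * y\<^sup>2 = 4 * g * (p * n)" and a: "\<alpha> = quad_elt d g u y"
    using \<alpha> by (rule norm_set_E)
  obtain h s w where h: "h \<in> {1, r}" and s: "s\<^sup>2 + d * w\<^sup>2 = 4 * h * p" and b: "\<pi> = quad_elt d h s w"
    using \<pi> by (rule norm_set_E)
  define k where "k = (if g = r \<and> h = r then 2 * r else 2)"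
  define G where "G = (if g = h then 1 else r)"
  have G: "G \<in> {1, r}" by (simp add: G_def)
  have s': "s\<^sup>2 + d * (- w)\<^sup>2 = 4 * h * p" using s by simp
  obtain U Y where "k * U = u * s - d * y * w" and Y: "k * Y = u * w + y * s" 
    and 1: "quad_elt d g u y * quad_elt d h s w = quad_elt d G U Y" "U\<^sup>2 + d * Y\<^sup>2 = 4 * G * (p * n * p)"
    using mult_coords[OF g h u s, folded k_def G_def] by blast
  obtain U' Y' where "k * U' = u * s - d * y * (- w)" and Y': "k * Y' = u * (- w) + y * s" 
    and 2: "quad_elt d g u y * quad_elt d h s (- w) = quad_elt d G U' Y'" "U'\<^sup>2 + d * Y'\<^sup>2 = 4 * G * (p * n * p)"
    using mult_coords[OF g h u s', folded k_def G_def] by blast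
  have prods: "\<alpha> * \<pi> = quad_elt d G U Y" "\<alpha> * cnj \<pi> = quad_elt d G U' Y'"
    using 1 2 by (simp_all add: a b cnj_quad_elt)
  have "k\<^sup>2 * (Y * Y') = (k * Y) * (k * Y')" by (simp add: power2_eq_square)
  also have "\<dots> = y\<^sup>2 * (s\<^sup>2 + d * w\<^sup>2) - w\<^sup>2 * (u\<^sup>2 + d * y\<^sup>2)" 
    unfolding Y Y' by (simp add: power2_eq_square algebra_simps)
  also have "\<dots> = 4 * (p * (h * y\<^sup>2 - g * n * w\<^sup>2))" unfolding u s by (simp add: algebra_simps)
  finally have *: "k\<^sup>2 * (Y * Y') = 4 * (p * (h * y\<^sup>2 - g * n * w\<^sup>2))" .
  have "p dvd Y * Y'"
  proof (cases "g = r \<and> h = r")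
    case True
    \<comment> \<open>Here k^2 = 4 r^2 exceeds the factor r on the right by one r, which is harmless
      as p differs from r.\<close>
    then have "r * (r * (Y * Y')) = r * (p * (y\<^sup>2 - n * w\<^sup>2))"
      using * by (simp add: k_def power2_eq_square algebra_simps)
    then have "r * (Y * Y') = p * (y\<^sup>2 - n * w\<^sup>2)" using r_gt_1 by simp
    then have "p dvd r * (Y * Y')" by simp
    moreover have "\<not> p dvd r" using p prime_r primes_dvd_imp_eq by blast
    ultimately show ?thesis using p(1) prime_dvd_mult_iff by blast
  next
    case False
    then show ?thesis using * by (auto simp: k_def)
  qed
  then have or: "p dvd Y \<or> p dvd Y'" using p(1) prime_dvd_mult_iff by blast
  have "p \<noteq> 0" using p by auto
  have "\<pi> * cnj \<pi> = of_int p" using \<pi> by (rule norm_set_mult_cnj)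
  then have "\<pi> \<noteq> 0" "of_int p = \<pi> * cnj \<pi>" using \<open>p \<noteq> 0\<close> by auto
  then have "\<alpha> * \<pi> / of_int p = \<alpha> / cnj \<pi>" "\<alpha> * cnj \<pi> / of_int p = \<alpha> / \<pi>" by simp_all
  moreover have "\<alpha> * \<pi> / of_int p \<in> homog" if "p dvd Y"
    unfolding prods using that p(1) 1(2) by (intro exact_division[OF G, where n = n]) (simp_all add: mult_ac)
  moreover have "\<alpha> * cnj \<pi> / of_int p \<in> homog" if "p dvd Y'"
    unfolding prods using that p(1) 2(2) by (intro exact_division[OF G, where n = n]) (simp_all add: mult_ac)
  ultimately show ?thesis using or by auto
qed

lemma sqrt_r_mem: "of_real (sqrt (of_int r)) \<in> norm_set r"
proof -
  have "quad_elt d r (2 * r) 0 = of_real (sqrt (of_int r))"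
    using r_gt_1 by (simp add: quad_elt_def complex_eq_iff real_div_sqrt)
  moreover have "quad_elt d r (2 * r) 0 \<in> norm_set r" by (rule norm_set_I) (auto simp: power2_eq_square)
  ultimately show ?thesis by simp
qed

text \<open>The prime above r is generated by sqrt r. From grade 1 the division keeps the
  coordinates and merely reads them over 2 sqrt r; from grade r back to grade 1 both coordinates
  must lose a factor r.\<close>

lemma divide_sqrt_r:
  assumes "\<alpha> \<in> norm_set (r * n)"
  shows "\<alpha> / of_real (sqrt (of_int r)) \<in> homog"
proof -
  obtain g u y where g: "g \<in> {1, r}" and u: "u\<^sup>2 + d * y\<^sup>2 = 4 * g * (r * n)" and a: "\<alpha> = quad_elt d g u y"
    using assms by (rule norm_set_E)
  show ?thesis
  proof (cases "g = 1")
    case True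
    then have "\<alpha> / of_real (sqrt (of_int r)) = quad_elt d r u y"
      by (simp add: a quad_elt_def complex_eq_iff Re_divide_of_real Im_divide_of_real)
    moreover have "quad_elt d r u y \<in> homog" using u True by (intro homogI) auto
    ultimately show ?thesis by simp
  next
    case False
    then have g: "g = r" using g by simp
    have "4 * r dvd u\<^sup>2 + d * y\<^sup>2" unfolding u g by (rule dvd_triv_left)
    then have "r dvd u" by (rule r_dvd)
    then obtain u' where u': "u = r * u'" by blast
    have "r dvd y" using ram
    proof
      assume "r = 2 \<and> d mod 4 \<in> {1, 2}"
      then show ?thesis using parity[of g u y] u by auto
    next
      \<comment> \<open>As r divides d exactly once, the norm equation with r^2 on the right leaves
        a factor r for y^2.\<close>
      assume *: "odd r \<and> r dvd d \<and> \<not> r\<^sup>2 dvd d \<and> d mod 4 = 3"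
      then obtain d' where d': "d = r * d'" by blast
      have "r * (d' * y\<^sup>2) = r * (r * (4 * n - u'\<^sup>2))"
        using u by (simp add: g u' d' power2_eq_square algebra_simps)
      then have "d' * y\<^sup>2 = r * (4 * n - u'\<^sup>2)" using r_gt_1 by simp
      then have "r dvd d' * y\<^sup>2" by simp
      moreover have "\<not> r dvd d'" using * by (auto simp: d' power2_eq_square)
      ultimately show ?thesis using prime_r prime_dvd_mult_iff prime_dvd_power by blast
    qed
    then obtain y' where y': "y = r * y'" by blast
    have "\<alpha> / of_real (sqrt (of_int r)) = quad_elt d 1 u' y'"
      using r_gt_1 by (simp add: a g u' y' quad_elt_def complex_eq_iff Re_divide_of_real Im_divide_of_real field_simps)
    moreover have "r\<^sup>2 * (u'\<^sup>2 + d * y'\<^sup>2) = r\<^sup>2 * (4 * n)" using u g by (simp add: u' y' power2_eq_square algebra_simps)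
    then have "u'\<^sup>2 + d * y'\<^sup>2 = 4 * n" using r_gt_1 by simp
    then have "quad_elt d 1 u' y' \<in> homog" by (intro homogI) auto
    ultimately show ?thesis by simp
  qed
qed

lemma prime_dvd_norm:
  assumes p: "prime p" "p \<noteq> r" and g: "g \<in> {1, r}" and u: "u\<^sup>2 + d * y\<^sup>2 = 4 * g * (p * n)" and y: "p dvd y"
  shows "p dvd n"
proof -
  have "u\<^sup>2 = 4 * g * (p * n) - d * y\<^sup>2" using u by simp
  also have "p dvd \<dots>" using y by (simp add: power2_eq_square)
  finally have "p dvd u" using p prime_dvd_power by blast
  then obtain a b where a: "u = p * a" and b: "y = p * b" using y by (metis dvdE)
  have pg: "\<not> p dvd g" using g p prime_r primes_dvd_imp_eq by auto
  have p0: "p \<noteq> 0" using p by auto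
  have "p * (p * (a\<^sup>2 + d * b\<^sup>2)) = p * (4 * g * n)" using u by (simp add: a b power2_eq_square algebra_simps)
  then have *: "p * (a\<^sup>2 + d * b\<^sup>2) = 4 * g * n" using p0 by simp
  show ?thesis
  proof (cases "p = 2")
    case True
    then have "odd r" "d mod 4 = 3" using ram p by auto
    define e where "e = d div 4"
    \<comment> \<open>For d = 3 modulo 4 an even value of a^2 + d b^2 is a multiple of 4. This
      yields the factor 2 that the 4 in the norm equation would otherwise absorb.\<close>
    have d: "d = 4 * e + 3" using \<open>d mod 4 = 3\<close> unfolding e_def by presburger
    have **: "a\<^sup>2 + d * b\<^sup>2 = 2 * (g * n)" using * True by simp
    then have "even (a\<^sup>2 + d * b\<^sup>2)" by simp
    then have "even (a + b)" by (simp add: d)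
    then obtain c where "a + b = 2 * c" by blast
    then have ac: "a = 2 * c - b" by simp
    have "a\<^sup>2 + d * b\<^sup>2 = 4 * (c\<^sup>2 - c * b + b\<^sup>2 + e * b\<^sup>2)"
      unfolding ac d by (simp add: power2_eq_square algebra_simps)
    then have "g * n = 2 * (c\<^sup>2 - c * b + b\<^sup>2 + e * b\<^sup>2)" using ** by simp
    then have "p dvd g * n" using True by simp
    then show ?thesis using p pg prime_dvd_mult_iff by blast
  next
    case False
    have "p > 2" using False p(1) prime_ge_2_int[of p] by simp
    then have "\<not> p dvd 2" by (auto dest: zdvd_imp_le)
    moreover have "2 * (2 * (g * n)) = p * (a\<^sup>2 + d * b\<^sup>2)" using * by simp
    then have "p dvd 2 * (2 * (g * n))" by simp
    ultimately show ?thesis using p pg prime_dvd_mult_iff by blast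
  qed
qed

subsection \<open>Reduction theory and splitting of primes\<close>

text \<open>The field discriminant is \<open>- disc_root\<^sup>2 * d\<close>.\<close>

definition disc_root :: int where "disc_root = (if d mod 4 = 3 then 1 else 2)"

lemma reduced_disc_root:
  "\<lbrakk>\<bar>b\<bar> \<le> a; a \<le> c; b\<^sup>2 - 4 * a * c = - disc_root\<^sup>2 * d\<rbrakk>
      \<Longrightarrow> a = 1 \<or> a = r \<or> a = c \<and> 2 * a - \<bar>b\<bar> = r"
  using reduced[of b a c] by (simp add: disc_root_def)

text \<open>Multiplying a form by 4 g, where g is a value it takes, turns it into the norm form.
  With g = a this is completing the square. If a = c, the form is diagonal in x - y and x + y, and
  its value 2 a - |b| = r at (1, 1) or (1, -1) serves as g.\<close>

lemma form_values_reduced: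
  assumes b: "\<bar>b\<bar> \<le> a" "a \<le> c" and D: "b\<^sup>2 - 4 * a * c = - disc_root\<^sup>2 * d"
  shows "\<exists>g\<in>{1, r}. \<exists>u w. u\<^sup>2 + d * w\<^sup>2 = 4 * g * (a * x\<^sup>2 + b * x * y + c * y\<^sup>2)"
proof -
  consider "a \<in> {1, r}" | "a = c" "2 * a - \<bar>b\<bar> = r" using reduced_disc_root[OF assms] by auto
  then show ?thesis
  proof cases
    case 1
    have "4 * a * c = b\<^sup>2 + disc_root\<^sup>2 * d" using D by simp
    then have "(2 * a * x + b * y)\<^sup>2 + d * (disc_root * y)\<^sup>2 = 4 * a * (a * x\<^sup>2 + b * x * y) + (4 * a * c) * y\<^sup>2"
      by (simp add: power2_eq_square algebra_simps)
    also have "\<dots> = 4 * a * (a * x\<^sup>2 + b * x * y + c * y\<^sup>2)"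
      by (simp add: algebra_simps)
    finally show ?thesis using 1 by blast
  next
    case 2
    \<comment> \<open>The sign of \<open>b\<close>, so that one computation treats both
      signs.\<close>
    define e where "e = (if b \<ge> 0 then 1 else - 1 :: int)"
    have e: "\<bar>b\<bar> = e * b" "e\<^sup>2 = 1" by (auto simp: e_def)
    then have r: "r = 2 * a - e * b" using 2 by simp
    have "disc_root\<^sup>2 * d = 4 * a * a - e\<^sup>2 * b\<^sup>2" using D 2 e by simp
    then have d: "disc_root\<^sup>2 * d = r * (2 * a + e * b)" by (simp add: r power2_eq_square algebra_simps)
    have "(r * (x - e * y))\<^sup>2 + d * (disc_root * (x + e * y))\<^sup>2
        = r\<^sup>2 * (x - e * y)\<^sup>2 + (disc_root\<^sup>2 * d) * (x + e * y)\<^sup>2"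
      by (simp add: power_mult_distrib)
    also have "\<dots> = r * (r * (x - e * y)\<^sup>2 + (2 * a + e * b) * (x + e * y)\<^sup>2)"
      unfolding d by (simp add: power2_eq_square algebra_simps)
    also have "r * (x - e * y)\<^sup>2 + (2 * a + e * b) * (x + e * y)\<^sup>2 = 4 * (a * x\<^sup>2 + e\<^sup>2 * b * x * y + a * e\<^sup>2 * y\<^sup>2)"
      by (simp add: r power2_eq_square algebra_simps)
    finally have "(r * (x - e * y))\<^sup>2 + d * (disc_root * (x + e * y))\<^sup>2 = 4 * r * (a * x\<^sup>2 + b * x * y + c * y\<^sup>2)"
      using e 2 by simp
    then show ?thesis by blast
  qed
qed

text \<open>Gauss reduction: translate, then exchange the outer coefficients as long as this lowers
  the first one. The set of values does not change.\<close>

lemma form_values: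
  assumes "a > 0" "b\<^sup>2 - 4 * a * c = - disc_root\<^sup>2 * d"
  shows "\<exists>g\<in>{1, r}. \<exists>u w. u\<^sup>2 + d * w\<^sup>2 = 4 * g * (a * x\<^sup>2 + b * x * y + c * y\<^sup>2)"
  using assms
proof (induction "nat a" arbitrary: a b c x y rule: less_induct)
  case less
  \<comment> \<open>This translation replaces \<open>b\<close> by its centred residue modulo 2 a, in
    [-a, a).\<close>
  define k where "k = - ((b + a) div (2 * a))"
  define b' where "b' = b + 2 * a * k"
  define c' where "c' = a * k\<^sup>2 + b * k + c"
  have "b' = (b + a) mod (2 * a) - a"
    by (simp add: b'_def k_def minus_mult_div_eq_mod[symmetric])
  then have b': "\<bar>b'\<bar> \<le> a" using less.prems(1) pos_mod_bound[of "2 * a" "b + a"] pos_mod_sign[of "2 * a" "b + a"] by linarith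
  have D': "b'\<^sup>2 - 4 * a * c' = - disc_root\<^sup>2 * d"
    unfolding less.prems(2)[symmetric] by (simp add: b'_def c'_def power2_eq_square algebra_simps)
  have f: "a * x\<^sup>2 + b * x * y + c * y\<^sup>2 = a * (x - k * y)\<^sup>2 + b' * (x - k * y) * y + c' * y\<^sup>2"
    by (simp add: b'_def c'_def power2_eq_square algebra_simps)
  show ?case
  proof (cases "a \<le> c'")
    case True
    then show ?thesis unfolding f using form_values_reduced[OF b' _ D'] by blast
  next
    case False
    have "disc_root\<^sup>2 * d > 0" using d_gt_4 by (simp add: disc_root_def)
    moreover have "4 * a * c' = b'\<^sup>2 + disc_root\<^sup>2 * d" using D' by simp
    ultimately have "4 * a * c' > 0" using zero_le_power2[of b'] by linarith
    then have c': "c' > 0" using less.prems(1) by (simp add: zero_less_mult_iff)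
    have "(- b')\<^sup>2 - 4 * c' * a = - disc_root\<^sup>2 * d" using D' by (simp add: mult_ac)
    moreover have "nat c' < nat a" using False c' by simp
    ultimately have "\<exists>g\<in>{1, r}. \<exists>u w. u\<^sup>2 + d * w\<^sup>2 = 4 * g * (c' * y\<^sup>2 + (- b') * y * (- (x - k * y)) + a * (- (x - k * y))\<^sup>2)"
      using less.hyps c' by blast
    moreover have "a * (x - k * y)\<^sup>2 + b' * (x - k * y) * y + c' * y\<^sup>2
        = c' * y\<^sup>2 + (- b') * y * (- (x - k * y)) + a * (- (x - k * y))\<^sup>2"
      by (simp add: power2_eq_square algebra_simps)
    ultimately show ?thesis unfolding f by presburger
  qed
qed

text \<open>The class number enters here. If p does not divide y, then u / y is a square root of -d
  modulo p, which lifts to a form of the field discriminant with leading coefficient p. By reduction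
  its value p is the norm of a homogeneous element. If p divides y, then p divides \<alpha>.\<close>

lemma prime_splits:
  assumes p: "prime p" "p \<noteq> r" and \<alpha>: "\<alpha> \<in> norm_set (p * n)"
  shows "\<alpha> / of_int p \<in> homog \<or> norm_set p \<noteq> {}"
proof -
  obtain g u y where g: "g \<in> {1, r}" and u: "u\<^sup>2 + d * y\<^sup>2 = 4 * g * (p * n)" and a: "\<alpha> = quad_elt d g u y"
    using \<alpha> by (rule norm_set_E)
  show ?thesis
  proof (cases "p dvd y")
    case True
    then have "p dvd n" using prime_dvd_norm[OF p g u] by simp
    then obtain m where "n = p * m" by blast
    then show ?thesis using exact_division[OF g, of u y p m] u a p True by simp
  next
    case False
    have "\<exists>b. 4 * p dvd b\<^sup>2 + disc_root\<^sup>2 * d"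
    proof (cases "p = 2")
      case True
      then have "odd r" "d mod 4 = 3" using ram p by auto
      have "odd y" using False True by simp
      then have "odd u" using parity[of g u y] u \<open>d mod 4 = 3\<close> by auto
      obtain i j where i: "u = 2 * i + 1" and j: "y = 2 * j + 1" using \<open>odd y\<close> \<open>odd u\<close> by (auto elim!: oddE)
      have "even (i * (i + 1))" "even (j * (j + 1))" by simp_all
      then obtain i' j' where "i * (i + 1) = 2 * i'" "j * (j + 1) = 2 * j'" by (elim evenE)
      \<comment> \<open>Odd squares are 1 modulo 8, so the norm equation gives d = -1 modulo 8 and b
        = 1 works.\<close>
      then have "u\<^sup>2 = 8 * i' + 1" "y\<^sup>2 = 8 * j' + 1" by (simp_all add: i j power2_eq_square algebra_simps)
      then have "1 + d = 8 * (g * n - i' - d * j')" using u True by (simp add: algebra_simps)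
      then have "4 * p dvd 1\<^sup>2 + disc_root\<^sup>2 * d" using True \<open>d mod 4 = 3\<close> by (simp add: disc_root_def)
      then show ?thesis by blast
    next
      case odd: False
      have "coprime y p" using False p(1) prime_imp_coprime coprime_commute by blast
      then obtain z where z: "[y * z = 1] (mod p)" using cong_solve_coprime_int by blast
      define v where "v = u * z"
      have "[u\<^sup>2 + d * y\<^sup>2 = 0] (mod p)" using u by (simp add: cong_0_iff)
      then have "[z\<^sup>2 * (u\<^sup>2 + d * y\<^sup>2) = z\<^sup>2 * 0] (mod p)" by (rule cong_scalar_left)
      moreover have "z\<^sup>2 * (u\<^sup>2 + d * y\<^sup>2) = v\<^sup>2 + d * (y * z)\<^sup>2" by (simp add: v_def power2_eq_square algebra_simps)
      moreover have "[v\<^sup>2 + d * (y * z)\<^sup>2 = v\<^sup>2 + d * 1\<^sup>2] (mod p)"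
        by (intro cong_add cong_mult cong_pow z cong_refl)
      ultimately have v: "p dvd v\<^sup>2 + d" by (metis cong_0_iff cong_dvd_iff mult_zero_right power_one mult_1_right)
      have podd: "odd p" using odd p(1) prime_ge_2_int[of p] prime_odd_int[of p] by simp
      show ?thesis
      proof (cases "d mod 4 = 3")
        case True
        \<comment> \<open>Adding the odd p corrects the parity of the root without changing it
          modulo p; an odd root is needed modulo 4.\<close>
        define b where "b = (if odd v then v else v + p)"
        have "odd b" using podd by (simp add: b_def)
        then obtain i where "b = 2 * i + 1" by (rule oddE)
        moreover define e where "e = d div 4"
        have "d = 4 * e + 3" using True unfolding e_def by presburger
        ultimately have "b\<^sup>2 + d = 4 * (i * i + i + 1 + e)" by (simp add: power2_eq_square algebra_simps)
        then have "4 dvd b\<^sup>2 + d" by simp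
        moreover have "p dvd b\<^sup>2 + d"
        proof -
          have "(v + p)\<^sup>2 + d = (v\<^sup>2 + d) + p * (2 * v + p)" by (simp add: power2_eq_square algebra_simps)
          then have "p dvd (v + p)\<^sup>2 + d" using v by (metis dvd_add dvd_triv_left)
          then show ?thesis using v by (simp add: b_def)
        qed
        moreover have "coprime (2 * 2) p"
          using podd by (simp only: coprime_mult_left_iff coprime_left_2_iff_odd simp_thms)
        then have "coprime 4 p" by simp
        ultimately have "4 * p dvd b\<^sup>2 + d" by (simp add: divides_mult)
        then show ?thesis using True by (auto simp: disc_root_def)
      next
        case False
        have "(2 * v)\<^sup>2 + disc_root\<^sup>2 * d = 4 * (v\<^sup>2 + d)"
          using False by (simp add: disc_root_def)
        then have "4 * p dvd (2 * v)\<^sup>2 + disc_root\<^sup>2 * d" using v by (simp only: mult_dvd_mono dvd_refl)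
        then show ?thesis by blast
      qed
    qed
    then obtain b c where "b\<^sup>2 + disc_root\<^sup>2 * d = 4 * p * c" by (auto elim!: dvdE)
    then have "b\<^sup>2 - 4 * p * c = - disc_root\<^sup>2 * d" by simp
    moreover have "p > 0" using p(1) prime_gt_0_int by blast
    \<comment> \<open>The value p is taken at (1, 0).\<close>
    ultimately have "\<exists>g\<in>{1, r}. \<exists>u w. u\<^sup>2 + d * w\<^sup>2 = 4 * g * (p * 1\<^sup>2 + b * 1 * 0 + c * 0\<^sup>2)"
      using form_values by blast
    moreover have "p * 1\<^sup>2 + b * 1 * 0 + c * 0\<^sup>2 = p" by simp
    ultimately obtain h s w where "h \<in> {1, r}" "s\<^sup>2 + d * w\<^sup>2 = 4 * h * p" by metis
    then show ?thesis using norm_set_I by blast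
  qed
qed

lemma square_multiple_eq_square:
  fixes k s w :: int
  assumes "k * w\<^sup>2 = s\<^sup>2" and "\<And>q. k \<noteq> q\<^sup>2"
  shows "w = 0"
proof (rule ccontr)
  assume w: "w \<noteq> 0"
  have "w\<^sup>2 dvd s\<^sup>2" using assms(1) by (metis dvd_triv_right)
  then have "w dvd s" by (simp add: pow_divides_pow_iff)
  then obtain q where "s = w * q" by blast
  then have "k * w\<^sup>2 = q\<^sup>2 * w\<^sup>2" using assms(1) by (simp add: power_mult_distrib)
  then show False using w assms(2) by simp
qed

text \<open>The quotient t / p is 2 cos of the argument of \<pi> / cnj \<pi>. If it is an integer,
  it lies between -2 and 2 and \<pi> / cnj \<pi> is a root of unity of order 1, 2, 3, 4 or 6. Orders
  3, 4, 6 would make d or 3 d a square.\<close>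

lemma trace_square:
  assumes p: "prime p" and \<pi>: "\<pi> \<in> norm_set p"
  obtains t where "\<pi>\<^sup>2 + (cnj \<pi>)\<^sup>2 = of_int t" "p dvd t \<Longrightarrow> cnj \<pi> = \<pi> \<or> cnj \<pi> = - \<pi>"
proof -
  obtain h s w where h: "h \<in> {1, r}" and s: "s\<^sup>2 + d * w\<^sup>2 = 4 * h * p" and b: "\<pi> = quad_elt d h s w"
    using \<pi> by (rule norm_set_E)
  have pos: "h > 0" "p > 0" "d > 0" using h r_gt_1 p prime_gt_0_int d_gt_4 by auto
  have "4 * h dvd s\<^sup>2 + d * w\<^sup>2" unfolding s by simp
  then have "h dvd s" using h r_dvd by auto
  then have "h dvd s\<^sup>2" by (simp add: power2_eq_square)
  then obtain q where q: "s\<^sup>2 = h * q" by blast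
  have s2: "of_int s * of_int s = (of_int h * of_int q :: real)"
    using q by (metis of_int_mult power2_eq_square)
  have dw: "d * w\<^sup>2 = h * (4 * p - q)" using s q by (simp add: algebra_simps)
  then have "real_of_int (d * w\<^sup>2) = of_int (h * (4 * p - q))" by (simp only:)
  then have dw2: "(of_int w)\<^sup>2 * of_int d = (of_int h * (4 * of_int p - of_int q) :: real)"
    by (simp add: mult.commute)
  have "\<pi>\<^sup>2 + (cnj \<pi>)\<^sup>2 = of_real (2 * ((Re \<pi>)\<^sup>2 - (Im \<pi>)\<^sup>2))"
    by (simp add: complex_eq_iff power2_eq_square)
  also have "(Re \<pi>)\<^sup>2 = of_int q / 4"
    using pos s2 by (simp add: b quad_elt_def power_divide power_mult_distrib power2_eq_square)
  also have "(Im \<pi>)\<^sup>2 = (4 * of_int p - of_int q) / 4"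
    using pos dw2 by (simp add: b quad_elt_def power_divide power_mult_distrib)
  also have "2 * (of_int q / 4 - (4 * of_int p - of_int q) / 4) = (of_int (q - 2 * p) :: real)"
    by (simp add: field_simps)
  finally have t: "\<pi>\<^sup>2 + (cnj \<pi>)\<^sup>2 = of_int (q - 2 * p)" by simp
  have "cnj \<pi> = \<pi> \<or> cnj \<pi> = - \<pi>" if "p dvd q - 2 * p"
  proof -
    have "p dvd (q - 2 * p) + 2 * p" using that by (intro dvd_add) simp_all
    \<comment> \<open>Here j = t / p + 2: the values 0 and 4 mean that \<pi> is imaginary or real, 2
      is order 4, and 1 and 3 are orders 3 and 6.\<close>
    then obtain j where j: "q = p * j" by auto
    have "h * q \<ge> 0" "h * (4 * p - q) \<ge> 0" using q dw pos by (metis zero_le_power2, metis zero_le_mult_iff zero_le_power2 less_imp_le)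
    then have "q \<ge> 0" "q \<le> 4 * p" using pos by (simp_all add: zero_le_mult_iff)
    then have "j \<ge> 0" "j \<le> 4" using pos unfolding j by (simp_all add: zero_le_mult_iff mult.commute)
    then consider "j = 0" | "j = 1" | "j = 2" | "j = 3" | "j = 4" by linarith
    then show ?thesis
    proof cases
      case 1
      then have "s = 0" using q j by simp
      then show ?thesis by (simp add: b cnj_quad_elt uminus_quad_elt)
    next
      case 2
      then have "3 * d * w\<^sup>2 = (3 * s)\<^sup>2" using q dw j by (simp add: power_mult_distrib)
      then have "w = 0" using square_multiple_eq_square no_omega by blast
      then show ?thesis by (simp add: b cnj_quad_elt)
    next
      case 3
      then have "d * w\<^sup>2 = s\<^sup>2" using q dw j by simp
      then have "w = 0" using square_multiple_eq_square no_i by blast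
      then show ?thesis by (simp add: b cnj_quad_elt)
    next
      case 4
      then have "3 * d * w\<^sup>2 = s\<^sup>2" using q dw j by (simp add: power_mult_distrib)
      then have "w = 0" using square_multiple_eq_square no_omega by blast
      then show ?thesis by (simp add: b cnj_quad_elt)
    next
      case 5
      then have "w = 0" using dw j pos by simp
      then show ?thesis by (simp add: b cnj_quad_elt)
    qed
  qed
  then show ?thesis using that t by blast
qed

subsection \<open>Multiplicativity of the sum of squares\<close>

text \<open>Coefficients of a theta series with harmonic polynomial z^2. Its weight is 3, which is
  where the p^2 in \<open>hecke_coeff\<close> comes from.\<close>

definition square_sum :: "int \<Rightarrow> complex" where "square_sum n = (\<Sum>z\<in>norm_set n. z\<^sup>2)"

section \<open>Decomposing a norm set along a prime\<close>

lemma norm_set_zero_free: "n > 0 \<Longrightarrow> z \<in> norm_set n \<Longrightarrow> z \<noteq> 0"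
  by (auto simp: norm_set_def)

lemma divide_norm_set: 
  assumes "z \<in> norm_set (m * n)" "w \<in> norm_set m" "z / w \<in> homog" "m > 0"
  shows "z / w \<in> norm_set n"
  using assms by (simp add: norm_set_def norm_divide power_divide)

text \<open>Divisibility is a hypothesis so that the lemma serves both p = r, through
  \<open>divide_sqrt_r\<close>, and the other primes, through \<open>divides_either\<close>.\<close>

lemma norm_set_prime_mult:
  assumes p: "p > 0" and \<pi>: "\<pi> \<in> norm_set p"
    and div: "\<And>\<alpha>. \<alpha> \<in> norm_set (p * n) \<Longrightarrow> \<alpha> / \<pi> \<in> homog \<or> \<alpha> / cnj \<pi> \<in> homog"
  shows "norm_set (p * n) = (*) \<pi> ` norm_set n \<union> (*) (cnj \<pi>) ` norm_set n"
proof (intro equalityI subsetI)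
  fix \<alpha> assume \<alpha>: "\<alpha> \<in> norm_set (p * n)"
  have "\<pi> \<noteq> 0" using norm_set_zero_free[OF p \<pi>] .
  then have "\<alpha> = \<pi> * (\<alpha> / \<pi>)" "\<alpha> = cnj \<pi> * (\<alpha> / cnj \<pi>)" by simp_all
  moreover have "\<alpha> / \<pi> \<in> norm_set n \<or> \<alpha> / cnj \<pi> \<in> norm_set n"
    using div[OF \<alpha>] divide_norm_set[OF \<alpha> \<pi> _ p] divide_norm_set[OF \<alpha> cnj_norm_set[OF \<pi>] _ p] by blast
  ultimately show "\<alpha> \<in> (*) \<pi> ` norm_set n \<union> (*) (cnj \<pi>) ` norm_set n" by blast
next
  fix \<alpha> assume "\<alpha> \<in> (*) \<pi> ` norm_set n \<union> (*) (cnj \<pi>) ` norm_set n"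
  then show "\<alpha> \<in> norm_set (p * n)" using mult_norm_set[OF \<pi>] mult_norm_set[OF cnj_norm_set[OF \<pi>]] by auto
qed

lemma norm_set_prime_inert:
  assumes p: "prime p" "p \<noteq> r" and "norm_set p = {}" and norm_set: "norm_set (p * n) \<noteq> {}"
  obtains m where "n = p * m" "norm_set (p * n) = (*) (of_int p) ` norm_set m"
proof -
  have p0: "p > 0" using p prime_gt_0_int by blast
  have *: "\<alpha> / of_int p \<in> homog" if "\<alpha> \<in> norm_set (p * n)" for \<alpha>
    using prime_splits[OF p that] assms(3) by blast
  have norm: "(cmod (\<alpha> / of_int p))\<^sup>2 = of_int n / of_int p" if "\<alpha> \<in> norm_set (p * n)" for \<alpha>
    using that p0 by (simp add: norm_set_def norm_divide power_divide power2_eq_square)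
  obtain \<alpha> where \<alpha>: "\<alpha> \<in> norm_set (p * n)" using norm_set by blast
  \<comment> \<open>The quotient by p is homogeneous, so its norm n / p is an integer.\<close>
  then obtain m where "(cmod (\<alpha> / of_int p))\<^sup>2 = of_int m" using homog_norm[OF *] by metis
  then have "real_of_int n = of_int (p * m)" using norm[OF \<alpha>] p0 by (simp add: field_simps)
  then have m: "n = p * m" by (simp only: of_int_eq_iff)
  have "norm_set (p * n) = (*) (of_int p) ` norm_set m"
  proof (intro equalityI subsetI)
    fix \<beta> assume \<beta>: "\<beta> \<in> norm_set (p * n)"
    then have "\<beta> / of_int p \<in> norm_set m" using *[OF \<beta>] norm[OF \<beta>] p0 by (simp add: norm_set_def m)
    moreover have "\<beta> = of_int p * (\<beta> / of_int p)" using p0 by simp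
    ultimately show "\<beta> \<in> (*) (of_int p) ` norm_set m" by blast
  next
    fix \<beta> assume "\<beta> \<in> (*) (of_int p) ` norm_set m"
    then show "\<beta> \<in> norm_set (p * n)" 
      by (auto simp: norm_set_def m int_mult_homog norm_mult power_mult_distrib) (simp add: power2_eq_square)
  qed
  then show ?thesis using that m by blast
qed

text \<open>The classification goes by \<pi> and not by the discriminant: \<open>ramified\<close>
  says that \<pi> and its conjugate agree up to sign, hence have the same multiples. It includes p =
  r with \<pi> = sqrt r.\<close>

lemma prime_cases:
  assumes p: "prime p"
  obtains (inert) "p \<noteq> r" "norm_set p = {}"
  | (ramified) \<pi> where "\<pi> \<in> norm_set p" "cnj \<pi> = \<pi> \<or> cnj \<pi> = - \<pi>"
      "\<And>n \<alpha>. \<alpha> \<in> norm_set (p * n) \<Longrightarrow> \<alpha> / \<pi> \<in> homog \<or> \<alpha> / cnj \<pi> \<in> homog"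
  | (split) \<pi> t where "p \<noteq> r" "\<pi> \<in> norm_set p" "\<pi>\<^sup>2 + (cnj \<pi>)\<^sup>2 = of_int t" "\<not> p dvd t"
      "\<And>n \<alpha>. \<alpha> \<in> norm_set (p * n) \<Longrightarrow> \<alpha> / \<pi> \<in> homog \<or> \<alpha> / cnj \<pi> \<in> homog"
proof (cases "p = r")
  case True
  show ?thesis
    by (rule ramified[of "of_real (sqrt (of_int r))"]) (use True sqrt_r_mem divide_sqrt_r in auto)
next
  case False
  show ?thesis
  proof (cases "norm_set p = {}")
    case True
    then show ?thesis using inert False by blast
  next
    case nonempty: False
    then obtain \<pi> where \<pi>: "\<pi> \<in> norm_set p" by blast
    obtain t where "\<pi>\<^sup>2 + (cnj \<pi>)\<^sup>2 = of_int t" "p dvd t \<Longrightarrow> cnj \<pi> = \<pi> \<or> cnj \<pi> = - \<pi>"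
      using trace_square[OF p \<pi>] by blast
    then show ?thesis using ramified split \<pi> divides_either[OF p False _ \<pi>] False by blast
  qed
qed

text \<open>Removing a prime shifts all elements of norm n by the same grade, since \<pi> and cnj
  \<pi> share their grade and integers have grade 1. The induction ends at norm 1.\<close>

lemma norm_set_one_grade:
  assumes "n > 0"
  obtains g where "g \<in> {1, r}" "norm_set n \<subseteq> grade g"
proof -
  have "\<exists>g\<in>{1, r}. norm_set n \<subseteq> grade g" using assms
  proof (induction "nat n" arbitrary: n rule: less_induct)
    case less
    have mult: "\<exists>g\<in>{1, r}. (*) a ` A \<union> (*) b ` A \<subseteq> grade g"
      if h: "h \<in> {1, r}" "a \<in> grade h" "b \<in> grade h" and A: "\<exists>g\<in>{1, r}. A \<subseteq> grade g" for h a b A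
    proof -
      obtain g where g: "g \<in> {1, r}" "A \<subseteq> grade g" using A by blast
      then have "(*) a ` A \<union> (*) b ` A \<subseteq> grade (if h = g then 1 else r)"
        using grade_mult[OF h(1) g(1)] h by blast
      then show ?thesis by (intro bexI[of _ "if h = g then 1 else r"]) auto
    qed
    show ?case
    proof (cases "norm_set n = {} \<or> n = 1")
      case True
      moreover have "z \<in> grade 1" if "z \<in> norm_set 1" for z
      proof -
        obtain g u y where g: "g \<in> {1, r}" and u: "u\<^sup>2 + d * y\<^sup>2 = 4 * g * 1" and z: "z = quad_elt d g u y"
          using \<open>z \<in> norm_set 1\<close> by (rule norm_set_E)
        \<comment> \<open>An element of norm 1 and grade r, times sqrt r, would generate R.\<close>
        then have "g = 1" using no_norm_r by auto
        then show ?thesis using u z by (auto intro: gradeI)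
      qed
      ultimately show ?thesis by blast
    next
      case False
      then have "nat n \<noteq> 1" "\<bar>n\<bar> \<noteq> 1" using less.prems by auto
      then obtain p where p: "prime p" "p dvd n" using prime_divisor_exists[of n] less.prems
        by (metis zdvd1_eq not_less_iff_gr_or_eq)
      then obtain n' where n: "n = p * n'" by blast
      have p1: "p > 1" using p prime_gt_1_int by blast
      then have n': "n' > 0" "nat n' < nat n" using less.prems n
        by (auto simp: zero_less_mult_iff)
      from p(1) show ?thesis
      proof (cases rule: prime_cases)
        case inert
        then obtain m where m: "n' = p * m" "norm_set n = (*) (of_int p) ` norm_set m"
          using norm_set_prime_inert[OF p(1), of n'] False n by metis
        have "m > 0" "m \<le> n'" using m n' p1 by (auto simp: zero_less_mult_iff)
        then obtain g where "g \<in> {1, r}" "norm_set m \<subseteq> grade g" using less.hyps[of m] n' by auto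
        then show ?thesis unfolding m using int_mult_grade by blast
      next
        case (ramified \<pi>)
        obtain h where h: "h \<in> {1, r}" "\<pi> \<in> grade h" using ramified(1) by (auto simp: norm_set_def homog_def)
        show ?thesis unfolding n
          using norm_set_prime_mult[OF _ ramified(1,3), of n'] mult[OF h cnj_grade[OF h(2)] less.hyps[OF n'(2,1)]] p1 by simp
      next
        case (split \<pi> t)
        obtain h where h: "h \<in> {1, r}" "\<pi> \<in> grade h" using split(2) by (auto simp: norm_set_def homog_def)
        show ?thesis unfolding n
          using norm_set_prime_mult[OF _ split(2,5), of n'] mult[OF h cnj_grade[OF h(2)] less.hyps[OF n'(2,1)]] p1 by simp
      qed
    qed
  qed
  then show ?thesis using that by blast
qed

lemma square_sum_image: "c \<noteq> 0 \<Longrightarrow> (\<Sum>z\<in>(*) c ` A. z\<^sup>2) = c\<^sup>2 * (\<Sum>z\<in>A. (z::complex)\<^sup>2)"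
  by (subst sum.reindex) (auto simp: inj_on_def power_mult_distrib sum_distrib_left)

text \<open>An element divisible by both primes above a split \<open>p\<close> is divisible by \<open>p\<close>: multiplying by
  \<open>t = \<pi>\<^sup>2 + (cnj \<pi>)\<^sup>2\<close>, which is invertible modulo \<open>p\<close>, produces the factor \<open>\<pi> * cnj \<pi>\<close>.\<close>

lemma inter_split:
  assumes p: "prime p" "p \<noteq> r" and \<pi>: "\<pi> \<in> norm_set p" and t: "\<pi>\<^sup>2 + (cnj \<pi>)\<^sup>2 = of_int t" "\<not> p dvd t"
    and n: "n > 0" and \<beta>: "\<beta> \<in> norm_set n" and \<gamma>: "\<gamma> \<in> norm_set n" and eq: "\<pi> * \<beta> = cnj \<pi> * \<gamma>"
  obtains m where "n = p * m" "\<pi> * \<beta> / of_int p \<in> norm_set m"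
proof -
  have p0: "p > 0" using p prime_gt_0_int by blast
  have norm: "\<pi> * cnj \<pi> = of_int p" using \<pi> by (rule norm_set_mult_cnj)
  have "of_int t * (\<pi> * \<beta>) = \<pi>\<^sup>2 * (\<pi> * \<beta>) + (\<pi> * cnj \<pi>) * cnj \<pi> * \<beta>"
    unfolding t(1)[symmetric] by (simp add: power2_eq_square algebra_simps)
  also have "\<dots> = (\<pi> * cnj \<pi>) * (\<pi> * \<gamma> + cnj \<pi> * \<beta>)"
    unfolding eq by (simp add: power2_eq_square algebra_simps)
  finally have key: "of_int t * (\<pi> * \<beta>) = of_int p * (\<pi> * \<gamma> + cnj \<pi> * \<beta>)" unfolding norm .
  \<comment> \<open>Coordinates in \<open>key\<close> can be compared only inside one grade, and
    this is where \<beta> and \<gamma>, being of equal norm, are known to share theirs.\<close>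
  obtain g where g: "g \<in> {1, r}" "norm_set n \<subseteq> grade g" using n by (rule norm_set_one_grade)
  obtain h where h: "h \<in> {1, r}" "\<pi> \<in> grade h" using \<pi> by (auto simp: norm_set_def homog_def)
  define G where "G = (if h = g then 1 else r)"
  have G: "G \<in> {1, r}" "G > 0" using r_gt_1 by (auto simp: G_def)
  have "\<pi> * \<beta> \<in> grade G" "\<pi> * \<gamma> \<in> grade G" "cnj \<pi> * \<beta> \<in> grade G"
    unfolding G_def using grade_mult[OF h(1) g(1)] h(2) g(2) \<beta> \<gamma> cnj_grade by blast+
  then obtain u y u1 y1 u2 y2 where 1: "\<pi> * \<beta> = quad_elt d G u y" 
    and 2: "\<pi> * \<gamma> = quad_elt d G u1 y1" "cnj \<pi> * \<beta> = quad_elt d G u2 y2"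
    unfolding grade_def by blast
  have "quad_elt d G (t * u) (t * y) = of_int t * (\<pi> * \<beta>)" unfolding 1
    by (simp add: quad_elt_def complex_eq_iff)
  also have "\<dots> = quad_elt d G (p * (u1 + u2)) (p * (y1 + y2))" unfolding key 2
    by (simp add: quad_elt_def complex_eq_iff algebra_simps add_divide_distrib)
  finally have "t * y = p * (y1 + y2)" using quad_elt_eq_iff G d_gt_4 by simp
  then have "p dvd t * y" by simp
  then have py: "p dvd y" using t(2) p(1) prime_dvd_mult_iff by blast
  have "\<pi> * \<beta> \<in> norm_set (p * n)" using \<pi> \<beta> by (rule mult_norm_set)
  then have N: "u\<^sup>2 + d * y\<^sup>2 = 4 * G * (p * n)" using cmod_grade[OF G(1), of u y "p * n"] by (simp add: 1 norm_set_def)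
  then have "p dvd n" using prime_dvd_norm[OF p G(1) _ py] by simp
  then obtain m where m: "n = p * m" by blast
  have "\<pi> * \<beta> / of_int p \<in> homog" unfolding 1
    using exact_division[OF G(1), of u y p m] N p py by (simp add: m)
  then have "\<pi> * \<beta> / of_int p \<in> norm_set m"
    using \<open>\<pi> * \<beta> \<in> norm_set (p * n)\<close> p0 by (simp add: norm_set_def m norm_divide power_divide power2_eq_square)
  then show ?thesis using that m by blast
qed

text \<open>Inclusion and exclusion over the multiples of \<pi> and of cnj \<pi>. Their overlap
  consists of the multiples of p, whence the term with p^2.\<close>

lemma square_sum_split:
  assumes p: "prime p" "p \<noteq> r" and \<pi>: "\<pi> \<in> norm_set p" and t: "\<pi>\<^sup>2 + (cnj \<pi>)\<^sup>2 = of_int t" "\<not> p dvd t"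
    and n: "n > 0" 
  shows "square_sum (p * n) = of_int t * square_sum n - (if p dvd n then of_int (p\<^sup>2) * square_sum (n div p) else 0)"
proof -
  let ?A = "(*) \<pi> ` norm_set n" and ?B = "(*) (cnj \<pi>) ` norm_set n"
  have p0: "p > 0" using p prime_gt_0_int by blast
  have \<pi>0: "\<pi> \<noteq> 0" using norm_set_zero_free[OF p0 \<pi>] .
  have norm: "\<pi> * cnj \<pi> = of_int p" using \<pi> by (rule norm_set_mult_cnj)
  have AB: "?A \<inter> ?B = (if p dvd n then (*) (of_int p) ` norm_set (n div p) else {})"
  proof (intro equalityI subsetI)
    fix z assume "z \<in> ?A \<inter> ?B"
    then obtain \<beta> \<gamma> where z: "\<beta> \<in> norm_set n" "\<gamma> \<in> norm_set n" "z = \<pi> * \<beta>" "\<pi> * \<beta> = cnj \<pi> * \<gamma>" by auto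
    then obtain m where m: "n = p * m" "z / of_int p \<in> norm_set m" using inter_split[OF p \<pi> t n] by metis
    moreover have "z = of_int p * (z / of_int p)" using p0 by simp
    ultimately show "z \<in> (if p dvd n then (*) (of_int p) ` norm_set (n div p) else {})"
      using p0 by (auto intro: image_eqI[where x = "z / of_int p"])
  next
    fix z assume "z \<in> (if p dvd n then (*) (of_int p) ` norm_set (n div p) else {})"
    then obtain m w where m: "n = p * m" "w \<in> norm_set m" "z = of_int p * w" using p0 by (auto split: if_splits)
    have "z = \<pi> * (cnj \<pi> * w)" "z = cnj \<pi> * (\<pi> * w)" unfolding m(3) norm[symmetric] by (simp_all add: mult_ac)
    moreover have "cnj \<pi> * w \<in> norm_set n" "\<pi> * w \<in> norm_set n" using m mult_norm_set[OF \<pi>] mult_norm_set[OF cnj_norm_set[OF \<pi>]] by auto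
    ultimately show "z \<in> ?A \<inter> ?B" by blast
  qed
  have "square_sum (p * n) = (\<Sum>z\<in>?A \<union> ?B. z\<^sup>2)"
    unfolding square_sum_def using norm_set_prime_mult[OF p0 \<pi> divides_either[OF p _ \<pi>]] by simp
  also have "\<dots> = (\<Sum>z\<in>?A. z\<^sup>2) + (\<Sum>z\<in>?B. z\<^sup>2) - (\<Sum>z\<in>?A \<inter> ?B. z\<^sup>2)"
    by (simp add: sum_Un finite_norm_set)
  also have "(\<Sum>z\<in>?A. z\<^sup>2) + (\<Sum>z\<in>?B. z\<^sup>2) = of_int t * square_sum n"
    using \<pi>0 by (simp add: square_sum_image square_sum_def distrib_right flip: t(1))
  also have "(\<Sum>z\<in>?A \<inter> ?B. z\<^sup>2) = (if p dvd n then of_int (p\<^sup>2) * square_sum (n div p) else 0)"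
    unfolding AB using p0 by (simp add: square_sum_image square_sum_def)
  finally show ?thesis .
qed

lemma square_sum_split_power:
  assumes p: "prime p" "p \<noteq> r" and \<pi>: "\<pi> \<in> norm_set p" and t: "\<pi>\<^sup>2 + (cnj \<pi>)\<^sup>2 = of_int t" "\<not> p dvd t"
    and n: "n > 0" "\<not> p dvd n"
  shows "square_sum (p ^ k * n) = of_int (hecke_coeff p t k) * square_sum n"
proof (induction k rule: induct_nat_012)
  case 1
  show ?case using square_sum_split[OF p \<pi> t n(1)] n by simp
next
  case (ge2 k)
  have p0: "p > 0" using p prime_gt_0_int by blast
  have "square_sum (p * (p ^ Suc k * n)) = of_int t * square_sum (p ^ Suc k * n) - of_int (p\<^sup>2) * square_sum (p ^ k * n)"
    using square_sum_split[OF p \<pi> t, of "p ^ Suc k * n"] n p0 by simp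
  then show ?case using ge2 by (simp add: algebra_simps)
qed simp

lemma square_sum_nonzero:
  assumes "n > 0" "norm_set n \<noteq> {}"
  shows "square_sum n \<noteq> 0"
  using assms
proof (induction "nat n" arbitrary: n rule: less_induct)
  case less
  show ?case
  proof (cases "n = 1")
    case True
    \<comment> \<open>As d > 4, the equation u^2 + d y^2 = 4 leaves only 1 and -1.\<close>
    have one: "z\<^sup>2 = 1" if "z \<in> norm_set 1" for z
    proof -
      obtain g u y where g: "g \<in> {1, r}" and u: "u\<^sup>2 + d * y\<^sup>2 = 4 * g * 1" and z: "z = quad_elt d g u y"
        using \<open>z \<in> norm_set 1\<close> by (rule norm_set_E)
      then have g1: "g = 1" using no_norm_r by auto
      have "y = 0"
      proof (rule ccontr)
        assume "y \<noteq> 0"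
        then have "y\<^sup>2 \<ge> 1" by (simp add: int_one_le_iff_zero_less)
        then have "d * 1 \<le> d * y\<^sup>2" using d_gt_4 by (intro mult_left_mono) auto
        moreover have "u\<^sup>2 \<ge> 0" by simp
        ultimately show False using u g1 d_gt_4 by linarith
      qed
      then have "u\<^sup>2 = 4" using u g1 by simp
      then have "real_of_int u * real_of_int u = 4" by (metis of_int_mult of_int_numeral power2_eq_square)
      then show ?thesis by (simp add: z g1 \<open>y = 0\<close> quad_elt_def complex_eq_iff power2_eq_square)
    qed
    have "square_sum 1 = of_nat (card (norm_set 1))" by (simp add: square_sum_def one)
    moreover have "card (norm_set 1) \<noteq> 0" using True less.prems finite_norm_set by simp
    ultimately show ?thesis using True by simp
  next
    case False
    then have "\<bar>n\<bar> \<noteq> 1" using less.prems by auto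
    then obtain p where p: "prime p" "p dvd n" using prime_divisor_exists[of n] less.prems
      by (metis zdvd1_eq not_less_iff_gr_or_eq)
    then obtain n' where n: "n = p * n'" by blast
    have p1: "p > 1" using p prime_gt_1_int by blast
    then have n': "n' > 0" "nat n' < nat n" using less.prems n
      by (auto simp: zero_less_mult_iff)
    from p(1) show ?thesis
    proof (cases rule: prime_cases)
      case inert
      then obtain m where m: "n' = p * m" "norm_set n = (*) (of_int p) ` norm_set m"
        using norm_set_prime_inert[OF p(1), of n'] less.prems n by metis
      have "m > 0" "m \<le> n'" using m n' p1 by (auto simp: zero_less_mult_iff)
      then have "square_sum m \<noteq> 0" using less.hyps[of m] n' less.prems(2) m(2) by auto
      then show ?thesis using p1 m(2) by (simp add: square_sum_def square_sum_image)
    next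
      case (ramified \<pi>)
      have \<pi>0: "\<pi> \<noteq> 0" using norm_set_zero_free[OF _ ramified(1)] p1 by simp
      \<comment> \<open>Both image sets coincide, so the sum is just multiplied by \<pi>^2.\<close>
      have "(*) (cnj \<pi>) ` norm_set n' = (*) \<pi> ` norm_set n'"
      proof (cases "cnj \<pi> = \<pi>")
        case False
        then have "cnj \<pi> = - \<pi>" using ramified by blast
        then have "(*) (cnj \<pi>) ` norm_set n' = (*) \<pi> ` uminus ` norm_set n'" by (simp add: image_image)
        also have "uminus ` norm_set n' = norm_set n'" using uminus_norm_set by (force simp: image_iff)
        finally show ?thesis .
      qed simp
      then have norm_set: "norm_set n = (*) \<pi> ` norm_set n'" using norm_set_prime_mult[OF _ ramified(1,3), of n'] p1 n by simp
      then have "square_sum n' \<noteq> 0" using less.hyps[OF n'(2,1)] less.prems(2) by auto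
      then show ?thesis using \<pi>0 by (simp add: square_sum_def norm_set square_sum_image)
    next
      case (split \<pi> t)
      \<comment> \<open>All powers of p are removed at once: the recursion subtracts, so a nonzero
        sum at n / p would not carry over to n by itself.\<close>
      obtain k n'' where k: "n = p ^ k * n''" "\<not> p dvd n''"
        using less.prems(1) p1 by (metis multiplicity_decompose' not_less_iff_gr_or_eq zdvd1_eq abs_of_pos zero_less_one order_less_trans less_irrefl)
      have k0: "k \<noteq> 0"
      proof
        assume "k = 0"
        then show False using k p(2) by simp
      qed
      have pk: "p ^ k > 0" using p1 by simp
      then have n'': "n'' > 0" using k(1) less.prems(1) zero_less_mult_pos by blast
      have "p ^ k > 1" using p1 k0 by (simp add: one_less_power)
      then have "n'' < n" using n'' by (simp add: k)
      have "norm_set (p ^ j * n'') \<noteq> {} \<Longrightarrow> norm_set n'' \<noteq> {}" for j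
      proof (induction j)
        case (Suc j)
        have "norm_set (p * (p ^ j * n'')) = (*) \<pi> ` norm_set (p ^ j * n'') \<union> (*) (cnj \<pi>) ` norm_set (p ^ j * n'')"
          using p1 by (intro norm_set_prime_mult split(2,5)) auto
        then show ?case using Suc by (auto simp: mult.assoc)
      qed simp
      then have "norm_set n'' \<noteq> {}" using less.prems(2) k by simp
      then have "square_sum n'' \<noteq> 0" using less.hyps[of n''] n'' \<open>n'' < n\<close> by simp
      then show ?thesis
        unfolding k square_sum_split_power[OF p(1) split(1,2,3,4) n'' k(2)]
        using hecke_coeff_nonzero[OF p(1) split(4)] by simp
    qed
  qed
qed

section \<open>Reduced forms and shells\<close>

text \<open>The first coordinate is twice the bilinear form at (i, j) and (x, y), where (i, j) is a
  vector of value g. This shape makes the real part of the matching element an inner product with a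
  fixed lattice vector; nothing beyond bijectivity is asked of \<open>W\<close>.\<close>

lemma reduced_form_param:
  assumes red: "reduced_form a b c" and D: "b\<^sup>2 - 4 * a * c = - disc_root\<^sup>2 * d"
  obtains g i j W where "g \<in> {1, r}" "a * i\<^sup>2 + b * i * j + c * j\<^sup>2 = g"
    "\<forall>n. bij_betw (\<lambda>(x, y). (2 * (a * i * x + c * j * y) + b * (i * y + j * x), W x y))
        {(x, y). a * x\<^sup>2 + b * x * y + c * y\<^sup>2 = n} {(u, w). u\<^sup>2 + d * w\<^sup>2 = 4 * g * n}"
proof -
  have b: "\<bar>b\<bar> \<le> a" "a \<le> c" "a > 0" "a = c \<Longrightarrow> b \<ge> 0" using red by (auto simp: reduced_form_def)
  have D': "4 * a * c = b\<^sup>2 + disc_root\<^sup>2 * d" using D by simp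
  consider "a \<in> {1, r}" | "a = c" "2 * a - b = r" using reduced_disc_root[OF b(1,2) D] b(4) by auto
  then show ?thesis
  proof cases
    case 1
    define U where "U x y = 2 * a * x + b * y" for x y
    have norm: "(U x y)\<^sup>2 + d * (disc_root * y)\<^sup>2 = 4 * a * (a * x\<^sup>2 + b * x * y + c * y\<^sup>2)" for x y
    proof -
      have "(U x y)\<^sup>2 + d * (disc_root * y)\<^sup>2 = 4 * a * (a * x\<^sup>2 + b * x * y) + (4 * a * c) * y\<^sup>2"
        unfolding D' by (simp add: U_def power2_eq_square algebra_simps)
      then show ?thesis by (simp add: algebra_simps)
    qed
    \<comment> \<open>Surjectivity is the arithmetic content: integrality of the norm must imply the
      congruences that make x and y integers.\<close>
    have surj: "\<exists>x y. u = U x y \<and> w = disc_root * y" if uw: "u\<^sup>2 + d * w\<^sup>2 = 4 * a * n" for u w n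
    proof -
      have dvd: "4 * a dvd u\<^sup>2 + d * w\<^sup>2" using uw by simp
      have "\<exists>y. w = disc_root * y \<and> 2 * a dvd u - b * y"
      proof (cases "d mod 4 = 3")
        case True
        moreover from this have "odd d" by presburger
        ultimately have odd: "odd r" "even (u + w)" "odd d" and "r dvd d"
          using parity[OF dvd] ram by auto
        have "even (b\<^sup>2 + d)" using D' True by (metis disc_root_def dvd_mult2 even_numeral mult_1 power_one)
        then have "odd b" using odd by simp
        then have ev: "even (u - b * w)" using odd by auto
        moreover have "r dvd u - b * w" if "a = r"
        proof -
          have "b\<^sup>2 = r * (4 * c) - d" using D' True that by (simp add: disc_root_def)
          then have "r dvd b\<^sup>2" using \<open>r dvd d\<close> by simp
          then have "r dvd b" using prime_r prime_dvd_power by blast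
          moreover have "r dvd u" using dvd that r_dvd by blast
          ultimately show ?thesis by simp
        qed
        moreover have "coprime 2 r" using odd(1) by simp
        ultimately have "2 * a dvd u - b * w"
        proof (cases "a = r")
          case True
          then show ?thesis using divides_mult[OF ev _ \<open>coprime 2 r\<close>] \<open>a = r \<Longrightarrow> r dvd u - b * w\<close> by blast
        next
          case False
          then have "a = 1" using 1 by blast
          then show ?thesis using ev by (simp only: mult_1_right)
        qed
        then show ?thesis using True by (simp add: disc_root_def)
      next
        case False
        then have "r = 2" "even u" "even w" using parity[OF dvd] by auto
        then obtain u' y where u: "u = 2 * u'" "w = 2 * y" by blast
        have "b\<^sup>2 = 4 * (a * c - d)" using D' False by (simp add: disc_root_def)
        then have "even b" by (metis dvd_mult2 even_numeral even_power pos2)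
        then obtain b' where b': "b = 2 * b'" by blast
        have "u'\<^sup>2 + d * y\<^sup>2 = a * n" "b'\<^sup>2 + d = a * c" using uw D' False
          by (simp_all add: u b' disc_root_def power_mult_distrib)
        moreover have "even (u' - b' * y)" if "even (u'\<^sup>2 + d * y\<^sup>2)" "even (b'\<^sup>2 + d)"
          using that by auto
        ultimately have "a dvd u' - b' * y" using 1 \<open>r = 2\<close> by (metis dvd_triv_left insertE one_dvd singletonD)
        then have "2 * a dvd u - b * y" by (auto simp: u b' elim!: dvdE) (metis dvd_triv_left right_diff_distrib mult.assoc)
        then show ?thesis using False u by (auto simp: disc_root_def)
      qed
      then obtain x y where "u - b * y = 2 * a * x" "w = disc_root * y" by (auto elim!: dvdE)
      then show ?thesis by (intro exI[of _ x] exI[of _ y]) (simp add: U_def)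
    qed
    have "bij_betw (\<lambda>(x, y). (2 * (a * 1 * x + c * 0 * y) + b * (1 * y + 0 * x), disc_root * y))
        {(x, y). a * x\<^sup>2 + b * x * y + c * y\<^sup>2 = n} {(u, w). u\<^sup>2 + d * w\<^sup>2 = 4 * a * n}" for n
    proof -
      have eq: "(\<lambda>(x, y). (2 * (a * 1 * x + c * 0 * y) + b * (1 * y + 0 * x), disc_root * y)) = (\<lambda>(x, y). (U x y, disc_root * y))"
        by (simp add: U_def mult.assoc)
      show ?thesis unfolding eq
      proof (rule bij_betwI')
        fix p q :: "int \<times> int"
        show "(case p of (x, y) \<Rightarrow> (U x y, disc_root * y)) = (case q of (x, y) \<Rightarrow> (U x y, disc_root * y)) \<longleftrightarrow> p = q"
          using b(3) by (auto simp: U_def disc_root_def split: prod.splits if_splits)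
      next
        fix p assume "p \<in> {(x, y). a * x\<^sup>2 + b * x * y + c * y\<^sup>2 = n}"
        then show "(case p of (x, y) \<Rightarrow> (U x y, disc_root * y)) \<in> {(u, w). u\<^sup>2 + d * w\<^sup>2 = 4 * a * n}"
          by (auto simp: norm)
      next
        fix q assume "q \<in> {(u, w). u\<^sup>2 + d * w\<^sup>2 = 4 * a * n}"
        then obtain u w where q: "q = (u, w)" "u\<^sup>2 + d * w\<^sup>2 = 4 * a * n" by blast
        then obtain x y where xy: "u = U x y" "w = disc_root * y" using surj by blast
        then have "4 * a * (a * x\<^sup>2 + b * x * y + c * y\<^sup>2) = 4 * a * n" using q norm[of x y] by simp
        then have "a * x\<^sup>2 + b * x * y + c * y\<^sup>2 = n" using b(3) by simp
        then show "\<exists>p\<in>{(x, y). a * x\<^sup>2 + b * x * y + c * y\<^sup>2 = n}. q = (case p of (x, y) \<Rightarrow> (U x y, disc_root * y))"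
          using q xy by (intro bexI[of _ "(x, y)"]) auto
      qed
    qed
    then show ?thesis using that[of a 1 0 "\<lambda>x y. disc_root * y"] 1 by simp
  next
    case 2
    have "r * (2 * a + b) = 4 * a * a - b\<^sup>2"
      unfolding 2(2)[symmetric] by (simp add: power2_eq_square algebra_simps)
    then have fac: "disc_root\<^sup>2 * d = r * (2 * a + b)" using D' 2(1) by simp
    have d3: "d mod 4 = 3"
    proof (rule ccontr)
      assume "d mod 4 \<noteq> 3"
      then have "r = 2" "2 * d = 2 * a + b" using ram fac by (auto simp: disc_root_def)
      \<comment> \<open>With r = 2 the bounds b <= a and 2 a - b = 2 give a <= 2, hence d <=
        3.\<close>
      then show False using 2 b d_gt_4 by linarith
    qed
    then have "odd r" using ram by auto
    have fac: "d = r * (2 * a + b)" using fac d3 by (simp add: disc_root_def)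
    have norm: "(r * (x - y))\<^sup>2 + d * (x + y)\<^sup>2 = 4 * r * (a * x\<^sup>2 + b * x * y + c * y\<^sup>2)" for x y
    proof -
      have "(r * (x - y))\<^sup>2 + d * (x + y)\<^sup>2 = r * (r * (x - y)\<^sup>2 + (2 * a + b) * (x + y)\<^sup>2)"
        unfolding fac by (simp add: power2_eq_square algebra_simps)
      also have "r * (x - y)\<^sup>2 + (2 * a + b) * (x + y)\<^sup>2 = 4 * (a * x\<^sup>2 + b * x * y + c * y\<^sup>2)"
        unfolding 2(2)[symmetric] 2(1)[symmetric] by (simp add: power2_eq_square algebra_simps)
      finally show ?thesis by simp
    qed
    have surj: "\<exists>x y. u = r * (x - y) \<and> w = x + y" if uw: "u\<^sup>2 + d * w\<^sup>2 = 4 * r * n" for u w n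
    proof -
      have dvd: "4 * r dvd u\<^sup>2 + d * w\<^sup>2" using uw by simp
      then have "r dvd u" by (rule r_dvd)
      then obtain u' where u: "u = r * u'" by blast
      have "even (u + w)" using parity[OF dvd] d3 by auto
      then have "even (u' + w)" using \<open>odd r\<close> by (simp add: u)
      then obtain x where "u' + w = 2 * x" by blast
      then show ?thesis by (intro exI[of _ x] exI[of _ "w - x"]) (simp add: u)
    qed
    have "bij_betw (\<lambda>(x, y). (2 * (a * 1 * x + c * (- 1) * y) + b * (1 * y + (- 1) * x), x + y))
        {(x, y). a * x\<^sup>2 + b * x * y + c * y\<^sup>2 = n} {(u, w). u\<^sup>2 + d * w\<^sup>2 = 4 * r * n}" for n
    proof -
      have eq: "(\<lambda>(x, y). (2 * (a * 1 * x + c * (- 1) * y) + b * (1 * y + (- 1) * x), x + y)) = (\<lambda>(x, y). (r * (x - y), x + y))"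
        by (auto simp flip: 2 simp: algebra_simps)
      show ?thesis unfolding eq
      proof (rule bij_betwI')
        fix p q :: "int \<times> int"
        show "(case p of (x, y) \<Rightarrow> (r * (x - y), x + y)) = (case q of (x, y) \<Rightarrow> (r * (x - y), x + y)) \<longleftrightarrow> p = q"
          using r_gt_1 by (auto split: prod.splits)
      next
        fix p assume "p \<in> {(x, y). a * x\<^sup>2 + b * x * y + c * y\<^sup>2 = n}"
        then show "(case p of (x, y) \<Rightarrow> (r * (x - y), x + y)) \<in> {(u, w). u\<^sup>2 + d * w\<^sup>2 = 4 * r * n}"
          by (auto simp: norm)
      next
        fix q assume "q \<in> {(u, w). u\<^sup>2 + d * w\<^sup>2 = 4 * r * n}"
        then obtain u w where q: "q = (u, w)" "u\<^sup>2 + d * w\<^sup>2 = 4 * r * n" by blast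
        then obtain x y where xy: "u = r * (x - y)" "w = x + y" using surj by blast
        then have "4 * r * (a * x\<^sup>2 + b * x * y + c * y\<^sup>2) = 4 * r * n" using q norm[of x y] by simp
        then have "a * x\<^sup>2 + b * x * y + c * y\<^sup>2 = n" using r_gt_1 by simp
        then show "\<exists>p\<in>{(x, y). a * x\<^sup>2 + b * x * y + c * y\<^sup>2 = n}. q = (case p of (x, y) \<Rightarrow> (r * (x - y), x + y))"
          using q xy by (intro bexI[of _ "(x, y)"]) auto
      qed
    qed
    then show ?thesis using that[of r 1 "- 1" "\<lambda>x y. x + y"] 2 by simp
  qed
qed

text \<open>The grades are kept apart by the irrationality of sqrt r.\<close>

lemma grade_inter:
  assumes "z \<in> grade 1" "z \<in> grade r"
  shows "z = 0"
proof -
  obtain u y where z1: "z = quad_elt d 1 u y" using assms(1) by (auto simp: grade_def)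
  obtain u' y' where z2: "z = quad_elt d r u' y'" using assms(2) by (auto simp: grade_def)
  note z = z1 z2
  have r: "sqrt (of_int r) > 0" "(sqrt (of_int r))\<^sup>2 = of_int r" using r_gt_1 by simp_all
  have nsq: "r \<noteq> q\<^sup>2" for q
  proof
    assume q: "r = q\<^sup>2"
    then have "r dvd q" using prime_r prime_dvd_power by (metis dvd_refl)
    then have "r * r dvd q * q" by (intro mult_dvd_mono)
    then have "r * r dvd r" using q by (simp add: power2_eq_square)
    then show False using r_gt_1 by (auto dest: zdvd_imp_le)
  qed
  have eq0: "v = 0" if "of_int v * sqrt (of_int r) = (of_int v' :: real)" for v v'
  proof -
    have "of_int (r * v\<^sup>2) = (of_int (v'\<^sup>2) :: real)"
      using that[symmetric] r by (simp add: power_mult_distrib)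
    then have "r * v\<^sup>2 = v'\<^sup>2" by (simp only: of_int_eq_iff)
    then show ?thesis using square_multiple_eq_square nsq by blast
  qed
  have "of_int u * sqrt (of_int r) = (of_int u' :: real)" "of_int y * sqrt (of_int r) = (of_int y' :: real)"
    using z r d_gt_4 by (simp_all add: quad_elt_def complex_eq_iff field_simps)
  then have "u = 0" "y = 0" using eq0 by blast+
  then show ?thesis using z by (simp add: quad_elt_def complex_eq_iff)
qed

text \<open>One solution fixes the grade of the whole norm set, because the two grades meet only in
  0.\<close>

lemma norm_set_eq_image:
  assumes "n > 0" "g \<in> {1, r}" "u\<^sup>2 + d * w\<^sup>2 = 4 * g * n"
  shows "norm_set n = (\<lambda>(u, w). quad_elt d g u w) ` {(u, w). u\<^sup>2 + d * w\<^sup>2 = 4 * g * n}"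
proof (intro equalityI subsetI)
  fix z assume z: "z \<in> norm_set n"
  obtain g' where g': "g' \<in> {1, r}" "norm_set n \<subseteq> grade g'" using assms(1) by (rule norm_set_one_grade)
  have "quad_elt d g u w \<in> norm_set n" using assms by (intro norm_set_I)
  moreover from this have "quad_elt d g u w \<noteq> 0" using norm_set_zero_free assms by blast
  moreover have "quad_elt d g u w \<in> grade g" using assms by (intro gradeI) simp
  ultimately have "g' = g" using g' assms(2) grade_inter by blast
  then have "z \<in> grade g" using z g' by blast
  then obtain u w where "z = quad_elt d g u w" by (auto simp: grade_def)
  moreover from this have "u\<^sup>2 + d * w\<^sup>2 = 4 * g * n" using z cmod_grade[OF assms(2), of u w n] by (simp add: norm_set_def)
  ultimately show "z \<in> (\<lambda>(u, w). quad_elt d g u w) ` {(u, w). u\<^sup>2 + d * w\<^sup>2 = 4 * g * n}" by auto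
next
  fix z assume "z \<in> (\<lambda>(u, w). quad_elt d g u w) ` {(u, w). u\<^sup>2 + d * w\<^sup>2 = 4 * g * n}"
  then show "z \<in> norm_set n" using assms norm_set_I by auto
qed

text \<open>The moment in a single direction controls only the real part; this symmetry removes the
  imaginary part.\<close>

lemma cnj_square_sum: "cnj (square_sum n) = square_sum n"
proof -
  have "cnj ` norm_set n = norm_set n" using cnj_norm_set by (force simp: image_iff)
  then have "square_sum n = (\<Sum>z\<in>cnj ` norm_set n. z\<^sup>2)" by (simp add: square_sum_def)
  also have "\<dots> = cnj (square_sum n)" by (subst sum.reindex) (auto simp: square_sum_def inj_on_def)
  finally show ?thesis by simp
qed

text \<open>Since Re(z^2) = 2 (Re z)^2 - |z|^2 and Re z is the inner product with v / sqrt g,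
  isotropy of the second moment of the shell amounts to Re(\<open>square_sum n\<close>) = 0.\<close>

lemma shell_not_design:
  fixes v1 v2 :: "real^2"
  assumes red: "reduced_form a b c" and D: "b\<^sup>2 - 4 * a * c = - disc_root\<^sup>2 * d"
    and L: "L = {of_int x *\<^sub>R v1 + of_int y *\<^sub>R v2 | x y. True}"
    and gram: "\<And>x y. (of_int x *\<^sub>R v1 + of_int y *\<^sub>R v2) \<bullet> (of_int x *\<^sub>R v1 + of_int y *\<^sub>R v2)
       = of_int (a * x\<^sup>2 + b * x * y + c * y\<^sup>2)"
    and m: "m > 0" "shell L m \<noteq> {}"
  shows "\<not> spherical_design 2 (shell L m)"
proof
  assume design: "spherical_design 2 (shell L m)"
  define P where "P = (\<lambda>(x, y). of_int x *\<^sub>R v1 + of_int y *\<^sub>R v2)"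
  obtain x0 y0 where xy0: "(of_int x0 *\<^sub>R v1 + of_int y0 *\<^sub>R v2) \<bullet> (of_int x0 *\<^sub>R v1 + of_int y0 *\<^sub>R v2) = m"
    using m(2) by (auto simp: shell_def L)
  define n where "n = a * x0\<^sup>2 + b * x0 * y0 + c * y0\<^sup>2"
  have mn: "m = of_int n" using xy0 unfolding gram n_def by simp
  have n0: "n > 0" using m(1) mn by simp
  define I where "I = {(x, y). a * x\<^sup>2 + b * x * y + c * y\<^sup>2 = n}"
  have v11: "v1 \<bullet> v1 = of_int a" using gram[of 1 0] by simp
  have v22: "v2 \<bullet> v2 = of_int c" using gram[of 0 1] by simp
  have v12: "2 * (v1 \<bullet> v2) = of_int b" using gram[of 1 1] v11 v22 by (simp add: inner_add inner_commute)
  have a0: "a > 0" using red by (simp add: reduced_form_def)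
  have shell: "shell L m = P ` I"
  proof -
    have "(P q \<bullet> P q = m) = (q \<in> I)" for q
      by (cases q) (simp only: P_def I_def mn gram prod.case mem_Collect_eq of_int_eq_iff)
    moreover have "L = range P" by (auto simp: L P_def image_iff)
    ultimately show ?thesis by (auto simp: shell_def)
  qed
  have inj: "inj P"
  proof (rule injI)
    fix p q assume "P p = P q"
    then obtain x y x' y' where pq: "p = (x, y)" "q = (x', y')" "P (x, y) = P (x', y')" by (metis surj_pair)
    have zero: "of_int (x - x') *\<^sub>R v1 + of_int (y - y') *\<^sub>R v2 = 0"
      using pq(3) by (simp add: P_def algebra_simps)
    have "real_of_int (a * (x - x')\<^sup>2 + b * (x - x') * (y - y') + c * (y - y')\<^sup>2) = 0"
      unfolding gram[symmetric] zero by simp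
    then have f0: "a * (x - x')\<^sup>2 + b * (x - x') * (y - y') + c * (y - y')\<^sup>2 = 0"
      by (simp only: of_int_eq_0_iff)
    \<comment> \<open>Completing the square shows that the Gram form is definite, so distinct
      coordinates give distinct points.\<close>
    have "(2 * a * (x - x') + b * (y - y'))\<^sup>2 + (disc_root\<^sup>2 * d) * (y - y')\<^sup>2
        = 4 * a * (a * (x - x')\<^sup>2 + b * (x - x') * (y - y')) + (b\<^sup>2 + disc_root\<^sup>2 * d) * (y - y')\<^sup>2"
      by (simp add: power2_eq_square algebra_simps)
    also have "b\<^sup>2 + disc_root\<^sup>2 * d = 4 * a * c" using D by simp
    also have "4 * a * (a * (x - x')\<^sup>2 + b * (x - x') * (y - y')) + 4 * a * c * (y - y')\<^sup>2
        = 4 * a * (a * (x - x')\<^sup>2 + b * (x - x') * (y - y') + c * (y - y')\<^sup>2)" by (simp add: algebra_simps)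
    finally have *: "(2 * a * (x - x') + b * (y - y'))\<^sup>2 + (disc_root\<^sup>2 * d) * (y - y')\<^sup>2 = 0" unfolding f0 by simp
    have "disc_root\<^sup>2 * d > 0" using d_gt_4 by (simp add: disc_root_def)
    then have "(disc_root\<^sup>2 * d) * (y - y')\<^sup>2 \<ge> 0" by simp
    then have "(disc_root\<^sup>2 * d) * (y - y')\<^sup>2 = 0" using * zero_le_power2[of "2 * a * (x - x') + b * (y - y')"] by linarith
    then have "y = y'" using \<open>disc_root\<^sup>2 * d > 0\<close> by auto
    then have "x = x'" using * a0 by simp
    then show "p = q" using pq \<open>y = y'\<close> by simp
  qed
  obtain g i j W where g: "g \<in> {1, r}" and gv: "a * i\<^sup>2 + b * i * j + c * j\<^sup>2 = g" and
    bij: "\<forall>n. bij_betw (\<lambda>(x, y). (2 * (a * i * x + c * j * y) + b * (i * y + j * x), W x y))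
        {(x, y). a * x\<^sup>2 + b * x * y + c * y\<^sup>2 = n} {(u, w). u\<^sup>2 + d * w\<^sup>2 = 4 * g * n}"
    by (rule reduced_form_param[OF red D])
  define v where "v = of_int i *\<^sub>R v1 + of_int j *\<^sub>R v2"
  define F where "F = (\<lambda>(x, y). (2 * (a * i * x + c * j * y) + b * (i * y + j * x), W x y))"
  define Q where "Q = (\<lambda>(u, w). quad_elt d g u w)"
  define N where "N = {(u, w). u\<^sup>2 + d * w\<^sup>2 = 4 * g * n}"
  have g0: "g > 0" using g r_gt_1 by auto
  have bijF: "bij_betw F I N" unfolding F_def I_def N_def using bij by blast
  have "(x0, y0) \<in> I" by (simp add: I_def n_def)
  then have "F (x0, y0) \<in> N" using bijF by (metis bij_betwE)
  then obtain u0 w0 where uw0: "u0\<^sup>2 + d * w0\<^sup>2 = 4 * g * n" by (auto simp: N_def)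
  have norm_set: "norm_set n = Q ` N" unfolding Q_def N_def by (rule norm_set_eq_image[OF n0 g uw0])
  have injQ: "inj_on Q N" using g0 d_gt_4 by (auto simp: inj_on_def Q_def quad_elt_eq_iff)
  have vv: "v \<bullet> v = of_int g" unfolding v_def gram gv by simp
  have Pv: "2 * (P q \<bullet> v) = of_int (fst (F q))" for q
  proof (cases q)
    case (Pair x y)
    have "2 * (P q \<bullet> v) = 2 * (of_int i * of_int x * (v1 \<bullet> v1) + of_int j * of_int y * (v2 \<bullet> v2))
        + (2 * (v1 \<bullet> v2)) * (of_int i * of_int y + of_int j * of_int x)"
      by (simp add: Pair P_def v_def inner_add inner_commute[of v2 v1] algebra_simps)
    then show ?thesis unfolding v11 v22 v12 by (simp add: Pair F_def algebra_simps)
  qed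
  have ReQ: "Re ((Q (F q))\<^sup>2) = 2 * (P q \<bullet> v)\<^sup>2 / of_int g - m" if "q \<in> I" for q
  proof -
    have "Q (F q) \<in> norm_set n" using that bijF norm_set by (auto dest: bij_betwE)
    then have "(Re (Q (F q)))\<^sup>2 + (Im (Q (F q)))\<^sup>2 = m" by (simp add: norm_set_def mn cmod_power2)
    moreover have "Re (Q (F q)) = (P q \<bullet> v) / sqrt (of_int g)"
      by (simp add: Q_def quad_elt_def case_prod_beta flip: Pv)
    then have "(Re (Q (F q)))\<^sup>2 = (P q \<bullet> v)\<^sup>2 / of_int g" using g0 by (simp add: power_divide)
    ultimately show ?thesis by (simp add: Re_power2)
  qed
  have "square_sum n = (\<Sum>p\<in>N. (Q p)\<^sup>2)" unfolding square_sum_def norm_set using injQ by (simp add: sum.reindex)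
  also have "\<dots> = (\<Sum>q\<in>I. (Q (F q))\<^sup>2)" by (rule sum.reindex_bij_betw[OF bijF, symmetric])
  finally have "Re (square_sum n) = (\<Sum>q\<in>I. 2 * (P q \<bullet> v)\<^sup>2 / of_int g - m)" using ReQ by simp
  also have "\<dots> = 2 * (\<Sum>q\<in>I. (P q \<bullet> v)\<^sup>2) / of_int g - m * card I"
    by (simp add: sum_subtractf sum_distrib_left sum_divide_distrib)
  also have "(\<Sum>q\<in>I. (P q \<bullet> v)\<^sup>2) = (\<Sum>x\<in>shell L m. (x \<bullet> v)\<^sup>2)"
    unfolding shell using inj by (subst sum.reindex) (auto intro: inj_on_subset)
  also have "2 * (\<Sum>x\<in>shell L m. (x \<bullet> v)\<^sup>2) = (v \<bullet> v) * m * real (card (shell L m))"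
    by (rule spherical_2_design_second_moment[OF design]) (simp add: shell_def)
  also have "card (shell L m) = card I" unfolding shell by (rule card_image) (rule inj_on_subset[OF inj], simp)
  also have "(v \<bullet> v) * m * real (card I) / of_int g - m * card I = 0" using g0 by (simp add: vv)
  finally have "Re (square_sum n) = 0" .
  moreover have "Im (square_sum n) = 0" using cnj_square_sum[of n] by (simp add: complex_eq_iff)
  ultimately have "square_sum n = 0" by (simp add: complex_eq_iff)
  moreover have "norm_set n \<noteq> {}" using norm_set uw0 by (auto simp: N_def)
  ultimately show False using square_sum_nonzero[OF n0] by blast
qed

end

section \<open>The fields of class number 2\<close>

text \<open>The second entry is 2 for d = 1, 2 modulo 4 and otherwise the smaller of the two prime
  divisors of d.\<close>

definition class_number_two :: "(int \<times> int) list" where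
  "class_number_two = [(5, 2), (6, 2), (10, 2), (13, 2), (15, 3), (22, 2), (35, 5), (37, 2), (51, 3),
    (58, 2), (91, 7), (115, 5), (123, 3), (187, 11), (235, 5), (267, 3), (403, 13), (427, 7)]"

text \<open>The third coefficient is eliminated through n = 4 a c. The bound 11 comes from 3 a^2 <=
  427.\<close>

lemma reduced_check:
  "\<forall>(d, r)\<in>set class_number_two. \<forall>a\<in>set [1..11]. \<forall>b\<in>set [0..a].
     let n = b * b + (if d mod 4 = 3 then d else 4 * d) in
       n mod (4 * a) = 0 \<longrightarrow> a * a * 4 \<le> n \<longrightarrow> a = 1 \<or> a = r \<or> n = 4 * a * a \<and> 2 * a - b = r"
  unfolding class_number_two_def by code_simp

text \<open>The largest number to test is 3 * 427 = 1281 < 37^2.\<close>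

lemma square_check:
  "\<forall>(d, r)\<in>set class_number_two. \<forall>q\<in>set [0..36]. d \<noteq> q * q \<and> 3 * d \<noteq> q * q"
  unfolding class_number_two_def by code_simp

text \<open>This certifies that R is not principal; 4 r <= 52 < 8^2 bounds both variables by
  7.\<close>

lemma norm_check:
  "\<forall>(d, r)\<in>set class_number_two. \<forall>u\<in>set [0..7]. \<forall>y\<in>set [0..7]. u * u + d * (y * y) \<noteq> 4 * r"
  unfolding class_number_two_def by code_simp

lemma le_of_square_less:
  fixes u k :: int
  assumes "u\<^sup>2 < (k + 1)\<^sup>2" "k \<ge> 0"
  shows "\<bar>u\<bar> \<le> k"
  using assms abs_le_square_iff[of "k + 1" u] by linarith

lemma two_class_table:
  assumes "(d, r) \<in> set class_number_two"
  shows "two_class d r"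
proof
  have bounds: "4 < d" "d \<le> 427" "r \<le> 13" "d mod 4 \<noteq> 3 \<Longrightarrow> d \<le> 58" 
    using assms by (auto simp: class_number_two_def)
  have "r \<in> {2, 3, 5, 7, 11, 13}" using assms by (auto simp: class_number_two_def)
  then show "prime r" by auto
  show "4 < d" by (rule bounds)
  show "(r = 2 \<and> d mod 4 \<in> {1, 2}) \<or> (odd r \<and> r dvd d \<and> \<not> r\<^sup>2 dvd d \<and> d mod 4 = 3)"
    using assms by (auto simp: class_number_two_def)
  show "u\<^sup>2 + d * y\<^sup>2 \<noteq> 4 * r" for u y
  proof
    assume eq: "u\<^sup>2 + d * y\<^sup>2 = 4 * r"
    have "1 * y\<^sup>2 \<le> d * y\<^sup>2" using bounds by (intro mult_right_mono) auto
    moreover have "(7 + 1 :: int)\<^sup>2 = 64" by simp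
    ultimately have "u\<^sup>2 < (7 + 1)\<^sup>2" "y\<^sup>2 < (7 + 1)\<^sup>2"
      using eq bounds(3) zero_le_power2[of u] zero_le_power2[of y] by linarith+
    then have "\<bar>u\<bar> \<le> 7" "\<bar>y\<bar> \<le> 7" using le_of_square_less[of _ 7] by simp_all
    then have "\<bar>u\<bar> \<in> set [0..7]" "\<bar>y\<bar> \<in> set [0..7]" by simp_all
    then have "\<bar>u\<bar> * \<bar>u\<bar> + d * (\<bar>y\<bar> * \<bar>y\<bar>) \<noteq> 4 * r" using norm_check assms by blast
    then show False using eq by (simp add: power2_eq_square)
  qed
  have sq: "\<bar>q\<bar> \<in> set [0..36]" if "q\<^sup>2 \<le> 1281" for q :: int
    using le_of_square_less[of q 36] that by simp
  show "d \<noteq> q\<^sup>2" "3 * d \<noteq> q\<^sup>2" for q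
    using sq[of q] square_check assms bounds by (fastforce simp: power2_eq_square)+
  fix a b c :: int
  assume b: "\<bar>b\<bar> \<le> a" and c: "a \<le> c" and D: "b\<^sup>2 - 4 * a * c = (if d mod 4 = 3 then - d else - 4 * d)"
  define n where "n = b * b + (if d mod 4 = 3 then d else 4 * d)"
  have n: "n = 4 * a * c" using D by (auto simp: n_def power2_eq_square split: if_splits)
  have "n > 0" using bounds by (auto simp: n_def intro: add_nonneg_pos)
  then have a0: "a > 0" using n b by (cases "a = 0") auto
  have "4 * a * a \<le> 4 * a * c" using c a0 by (intro mult_left_mono) auto
  moreover have "b * b \<le> a * a" using b abs_le_square_iff[of b a] a0 by (simp add: power2_eq_square)
  \<comment> \<open>From 4 a^2 <= n and b^2 <= a^2, as the absolute discriminant is at most 427: for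
    d = 1, 2 modulo 4 it is 4 d <= 232.\<close>
  ultimately have "3 * a\<^sup>2 \<le> 427" using n bounds by (auto simp: n_def power2_eq_square split: if_splits)
  then have "a \<le> 11" using le_of_square_less[of a 11] by simp
  then have "a \<in> set [1..11]" "\<bar>b\<bar> \<in> set [0..a]" using a0 b by simp_all
  then have "let n = \<bar>b\<bar> * \<bar>b\<bar> + (if d mod 4 = 3 then d else 4 * d) in
       n mod (4 * a) = 0 \<longrightarrow> a * a * 4 \<le> n \<longrightarrow> a = 1 \<or> a = r \<or> n = 4 * a * a \<and> 2 * a - \<bar>b\<bar> = r"
    using reduced_check assms by blast
  then have "n mod (4 * a) = 0 \<longrightarrow> a * a * 4 \<le> n \<longrightarrow> a = 1 \<or> a = r \<or> n = 4 * a * a \<and> 2 * a - \<bar>b\<bar> = r"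
    by (simp add: n_def Let_def)
  then show "a = 1 \<or> a = r \<or> a = c \<and> 2 * a - \<bar>b\<bar> = r"
    using n \<open>4 * a * a \<le> 4 * a * c\<close> a0 by (auto simp: mult_ac)
qed

text \<open>The class enters through its reduced form of the field discriminant, so one argument
  covers both classes.\<close>

lemma class_lattice_not_design:
  assumes d: "d \<in> {5, 6, 10, 13, 15, 22, 35, 37, 51, 58, 91, 115, 123, 187, 235, 267, 403, 427}"
    and L: "class_lattice d \<cc> L" and m: "m > 0" "shell L m \<noteq> {}"
  shows "\<not> spherical_design 2 (shell L m)"
proof -
  have "int d \<in> fst ` set class_number_two" using d by (auto simp: class_number_two_def)
  then obtain r where r: "(int d, r) \<in> set class_number_two" by auto
  interpret two_class "int d" r using r by (rule two_class_table)
  obtain a b c v1 v2 where form: "class_form d \<cc> a b c"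
    and L: "L = {of_int x *\<^sub>R v1 + of_int y *\<^sub>R v2 | x y. True}"
    and gram: "\<And>x y. (of_int x *\<^sub>R v1 + of_int y *\<^sub>R v2) \<bullet> (of_int x *\<^sub>R v1 + of_int y *\<^sub>R v2)
       = of_int (a * x\<^sup>2 + b * x * y + c * y\<^sup>2)"
    using L unfolding class_lattice_def by blast
  have "(- int d) mod 4 = 1 \<longleftrightarrow> int d mod 4 = 3" by presburger
  then have "field_disc d = - disc_root\<^sup>2 * int d" by (simp add: field_disc_def disc_root_def)
  then have "reduced_form a b c" "b\<^sup>2 - 4 * a * c = - disc_root\<^sup>2 * int d"
    using form by (simp_all add: class_form_def)
  then show ?thesis using shell_not_design[OF _ _ L gram m] by blast
qed

theorem theorem1p6:
  fixes d :: nat and m :: real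
  assumes "d \<in> {5, 6, 10, 13, 15, 22, 35, 37, 51, 58, 91, 115, 123, 187, 235, 267, 403, 427}"
    and "m > 0"
  shows "(\<forall>L. class_lattice d (principal_class d) L \<longrightarrow> shell L m \<noteq> {} \<longrightarrow>
            \<not> spherical_design 2 (shell L m)) \<and>
         (\<forall>\<aa>\<in>ideal_classes d. \<aa> \<noteq> principal_class d \<longrightarrow>
            (\<forall>L. class_lattice d \<aa> L \<longrightarrow> shell L m \<noteq> {} \<longrightarrow>
               \<not> spherical_design 2 (shell L m)))"
  using class_lattice_not_design[OF assms(1) _ assms(2)] by blast

end
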